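(* Let $\omega\approx 0.371859+0.519411i$ be the root of the polynomial $1-2z+2z^2-2z^5+2z^8$ with this approximate value. Then (1) $\omega\in\mathcal{M}$, $\omega\in\mathcal{M}_0$ and $\omega\in\mathcal{M}_1$; in fact $f\Lambda_\omega\cap g\Lambda_\omega=\{1/2\}$; (2) there are points of $\mathbb{D}^*\setminus\mathcal{M}$ arbitrarily close to $\omega$; (3) there are infinitely many rings of concentric closed loops contained in the interior of $\mathcal{M}$, each encircling $\omega$, which nest down to the point $\omega$. Consequently $\mathcal{M}$ has infinitely many holes, and these holes accumulate at $\omega$.
   Context: For $z\in\mathbb{D}^*=\{0<|z|<1\}$ let $f(x)=zx$, $g(x)=z(x-1)+1$, and let $\Lambda_z$ be the unique nonempty compact subset of $\mathbb{C}$ with $\Lambda_z=f(\Lambda_z)\cup g(\Lambda_z)$; write $f\Lambda_z=f(\Lambda_z)$, $g\Lambda_z=g(\Lambda_z)$. Define $\mathcal{M}=\{z\in\mathbb{D}^*:\Lambda_z\text{ connected}\}$, $\mathcal{M}_0=\{z\in\mathbb{D}^*:1/2\in\Lambda_z\}$, and $\mathcal{M}_1=\{z\in\mathbb{D}^*:\Lambda_z\text{ is connected and full}\}$, where a set is full if its complement in $\mathbb{C}$ is connected. One has $\mathcal{M}\subseteq\{|z|\ge 1/2\}$. A hole in $\mathcal{M}$ is a connected component of $\mathbb{D}^*\setminus\mathcal{M}$ other than the component containing $\{0<|z|<1/2\}$. *)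

theory Defs
  imports "HOL-Complex_Analysis.Complex_Analysis"
begin

definition punctured_disc :: "complex set" where
  "punctured_disc = {z. 0 < cmod z \<and> cmod z < 1}"

definition ifs_f :: "complex \<Rightarrow> complex \<Rightarrow> complex" where
  "ifs_f z x = z * x"

definition ifs_g :: "complex \<Rightarrow> complex \<Rightarrow> complex" where
  "ifs_g z x = z * (x - 1) + 1"

definition Lambda :: "complex \<Rightarrow> complex set" where
  "Lambda z = (THE K. compact K \<and> K \<noteq> {} \<and> K = ifs_f z ` K \<union> ifs_g z ` K)"

definition full :: "complex set \<Rightarrow> bool" where
  "full S \<longleftrightarrow> connected (- S)"

definition Mset :: "complex set" where
  "Mset = {z \<in> punctured_disc. connected (Lambda z)}"

definition M0 :: "complex set" where
  "M0 = {z \<in> punctured_disc. 1/2 \<in> Lambda z}"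

definition M1 :: "complex set" where
  "M1 = {z \<in> punctured_disc. connected (Lambda z) \<and> full (Lambda z)}"

definition hole :: "complex set \<Rightarrow> bool" where
  "hole H \<longleftrightarrow> H \<in> components (punctured_disc - Mset) \<and>
     \<not> {z. 0 < cmod z \<and> cmod z < 1/2} \<subseteq> H"

end

theory Submission
  imports Defs
begin

text \<open>Subtracting digit expansions, \<open>z\<close> lies in \<open>\<M>\<close> iff \<open>-1/z\<close> lies in the set \<open>\<Gamma>\<^sub>z\<close> of all sums
  \<open>\<Sum>c\<^sub>i z\<^sup>i\<close> with \<open>c\<^sub>i \<in> {-1, 0, 1}\<close>. For \<open>z\<close> near \<open>\<omega>\<close> the first seven digits of such an expansion
  of \<open>-1/z\<close> are forced, and then the digit 1 is forced as long as the tail stays close to \<open>1/(1 -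
  z)\<close>, from which it departs by a factor \<open>1/z\<close> per step. At \<open>\<omega>\<close> the tail never departs, so the
  expansion is unique with all digits nonzero, which gives \<open>f\<Lambda> \<inter> g\<Lambda> = {1/2}\<close>. For \<open>z = \<omega> + \<omega>\<^sup>k u /
  D\<close>, where \<open>D\<close> is the derivative at \<open>\<omega>\<close> of the initial deviation, the tail after \<open>k\<close> steps is
  close to \<open>1/(1 - \<omega>) - u\<close>. Hence \<open>\<M>\<close> near \<open>\<omega>\<close> is asymptotically a rescaled copy of \<open>\<Gamma>\<^sub>\<omega>\<close> near
  \<open>1/(1 - \<omega>)\<close>: a point \<open>u\<close> with \<open>1/(1 - \<omega>) - u \<notin> \<Gamma>\<^sub>\<omega>\<close> yields parameters in the complement of \<open>\<M>\<close>
  converging to \<open>\<omega>\<close>, and a circle around \<open>1/(1 - \<omega>)\<close> that stays robustly inside \<open>\<Gamma>\<^sub>z\<close> yields the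
  loops. Both facts about \<open>\<Gamma>\<^sub>z\<close> are finite computations in disc arithmetic; for the second, a
  rectangle covered by its own images under words of the maps \<open>t \<mapsto> z t + d\<close> is contained in
  \<open>\<Gamma>\<^sub>z\<close>.\<close>

subsection \<open>Digit expansions and the attractor\<close>

text \<open>For the digits -1, 0, 1 this is the set \<open>\<Gamma>\<^sub>z\<close>; for the digits
  0, 1 it is the attractor up to the factor \<open>1 - z\<close>.\<close>

definition series_set :: "int set \<Rightarrow> complex \<Rightarrow> complex set" where
  "series_set D z = {t. \<exists>c. (\<forall>i. c i \<in> D) \<and> (\<lambda>i. of_int (c i) * z ^ i) sums t}"

lemma sums_shift:
  fixes z t :: complex and c :: "nat \<Rightarrow> int"
  assumes "z \<noteq> 0"
  shows "(\<lambda>i. of_int (c (Suc i)) * z ^ i) sums ((t - of_int (c 0)) / z)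
    \<longleftrightarrow> (\<lambda>i. of_int (c i) * z ^ i) sums t"
proof -
  have "(\<lambda>i. of_int (c i) * z ^ i) sums t
      \<longleftrightarrow> (\<lambda>i. z * (of_int (c (Suc i)) * z ^ i)) sums (z * ((t - of_int (c 0)) / z))"
    using sums_Suc_iff[of "\<lambda>i. of_int (c i) * z ^ i" "t - of_int (c 0)"] assms
    by (simp add: mult_ac)
  then show ?thesis unfolding sums_mult_iff[OF assms] by (rule sym)
qed

lemma series_set_cons:
  assumes "z \<noteq> 0" "d \<in> D" "s \<in> series_set D z"
  shows "of_int d + z * s \<in> series_set D z"
proof -
  obtain c where c: "\<And>i. c i \<in> D" "(\<lambda>i. of_int (c i) * z ^ i) sums s"
    using assms(3) by (auto simp: series_set_def)
  have "(\<lambda>i. of_int (case_nat d c i) * z ^ i) sums (of_int d + z * s)"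
    using sums_shift[OF assms(1), of "case_nat d c" "of_int d + z * s"] c(2) assms(1) by simp
  moreover have "case_nat d c i \<in> D" for i
    using c(1) assms(2) by (cases i) auto
  ultimately show ?thesis
    unfolding series_set_def by blast
qed

lemma series_set_uncons:
  assumes "z \<noteq> 0" "t \<in> series_set D z"
  shows "\<exists>d\<in>D. (t - of_int d) / z \<in> series_set D z"
proof -
  obtain c where c: "\<And>i. c i \<in> D" "(\<lambda>i. of_int (c i) * z ^ i) sums t"
    using assms(2) by (auto simp: series_set_def)
  then have "(\<lambda>i. of_int (c (Suc i)) * z ^ i) sums ((t - of_int (c 0)) / z)"
    using sums_shift[OF assms(1)] by blast
  then have "(t - of_int (c 0)) / z \<in> series_set D z"
    unfolding series_set_def using c(1) by (intro CollectI exI[of _ "\<lambda>i. c (Suc i)"]) auto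
  then show ?thesis using c(1) by blast
qed

lemma bounded_power_mult_tendsto_zero:
  fixes z :: complex
  assumes "cmod z < 1" "bounded K" "\<And>n. x n \<in> K"
  shows "(\<lambda>n. z ^ n * x n) \<longlonglongrightarrow> 0"
proof -
  obtain B where B: "\<And>y. y \<in> K \<Longrightarrow> norm y \<le> B"
    using assms(2) bounded_iff by blast
  have "Bseq x" using B assms(3) by (intro BseqI'[of _ B]) auto
  moreover have "Zfun (\<lambda>n. z ^ n) sequentially"
    using LIMSEQ_power_zero[OF assms(1)] by (simp add: tendsto_Zfun_iff)
  ultimately have "Zfun (\<lambda>n. z ^ n * x n) sequentially"
    by (metis Bfun_def bounded_bilinear.Zfun_prod_Bfun bounded_bilinear_mult)
  then show ?thesis by (simp add: tendsto_Zfun_iff)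
qed

text \<open>Choosing an admissible digit at every point gives an orbit inside \<open>K\<close>. Its
  digits form the expansion, since the remainder \<open>z ^ n * x n\<close> tends to 0 for bounded
  \<open>K\<close>.\<close>

lemma series_set_coinduct:
  assumes z: "z \<noteq> 0" "cmod z < 1" and K: "bounded K"
    and step: "\<And>t. t \<in> K \<Longrightarrow> \<exists>d\<in>D. (t - of_int d) / z \<in> K"
  shows "K \<subseteq> series_set D z"
proof
  fix t assume t: "t \<in> K"
  obtain \<delta> where \<delta>: "\<And>s. s \<in> K \<Longrightarrow> \<delta> s \<in> D \<and> (s - of_int (\<delta> s)) / z \<in> K"
    using step by metis
  define x where "x n = ((\<lambda>s. (s - of_int (\<delta> s)) / z) ^^ n) t" for n
  have x0: "x 0 = t" and xS: "x (Suc n) = (x n - of_int (\<delta> (x n))) / z" for n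
    by (simp_all add: x_def)
  have xK: "x n \<in> K" for n
    by (induction n) (use t \<delta> in \<open>simp_all add: x0 xS\<close>)
  have part: "(\<Sum>i<n. of_int (\<delta> (x i)) * z ^ i) = t - z ^ n * x n" for n
  proof (induction n)
    case (Suc n)
    have "z ^ Suc n * x (Suc n) = z ^ n * x n - of_int (\<delta> (x n)) * z ^ n"
      using z(1) by (simp add: xS field_simps)
    then show ?case using Suc by (simp del: power_Suc)
  qed (simp add: x0)
  have "(\<lambda>n. t - z ^ n * x n) \<longlonglongrightarrow> t - 0"
    by (intro tendsto_diff tendsto_const bounded_power_mult_tendsto_zero[OF z(2) K xK])
  then have "(\<lambda>i. of_int (\<delta> (x i)) * z ^ i) sums t"
    by (simp add: sums_def part)
  then show "t \<in> series_set D z"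
    unfolding series_set_def using \<delta> xK by (intro CollectI exI[of _ "\<lambda>i. \<delta> (x i)"]) auto
qed

text \<open>Replacing the tail after \<open>n\<close> digits by some point of \<open>K\<close> gives
  a value in \<open>K\<close> that differs from the partial sum by a multiple of
  \<open>z ^ n\<close>.\<close>

lemma series_set_subset_closed:
  assumes z: "z \<noteq> 0" "cmod z < 1" and K: "closed K" "K \<noteq> {}"
    and step: "\<And>t d. t \<in> K \<Longrightarrow> d \<in> D \<Longrightarrow> of_int d + z * t \<in> K"
  shows "series_set D z \<subseteq> K"
proof
  fix t assume "t \<in> series_set D z"
  then obtain c where c: "\<And>i. c i \<in> D" "(\<lambda>i. of_int (c i) * z ^ i) sums t"
    by (auto simp: series_set_def)
  obtain x where x: "x \<in> K" using K(2) by blast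
  \<comment> \<open>The induction peels off the leading digit, hence the arbitrary starting index
    \<open>k\<close>.\<close>
  have mem: "(\<Sum>i<n. of_int (c (i + k)) * z ^ i) + z ^ n * x \<in> K" for n k
  proof (induction n arbitrary: k)
    case (Suc n)
    have eq: "(\<Sum>i<Suc n. of_int (c (i + k)) * z ^ i) + z ^ Suc n * x
        = of_int (c k) + z * ((\<Sum>i<n. of_int (c (i + Suc k)) * z ^ i) + z ^ n * x)"
      by (simp add: sum.lessThan_Suc_shift sum_distrib_left algebra_simps del: sum.lessThan_Suc)
    show ?case unfolding eq by (rule step[OF Suc c(1)])
  qed (use x in simp)
  have lim: "(\<lambda>n. (\<Sum>i<n. of_int (c i) * z ^ i) + z ^ n * x) \<longlonglongrightarrow> t + 0"
    using c(2) bounded_power_mult_tendsto_zero[OF z(2), of "{x}" "\<lambda>_. x"]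
    by (intro tendsto_add) (auto simp: sums_def)
  have "(\<Sum>i<n. of_int (c i) * z ^ i) + z ^ n * x \<in> K" for n
    using mem[of 0 n] by simp
  from closed_sequentially[OF K(1) this lim] show "t \<in> K" by simp
qed

lemma series_set_norm_le:
  assumes "cmod z < 1" "\<And>d. d \<in> D \<Longrightarrow> \<bar>d\<bar> \<le> 1" "t \<in> series_set D z"
  shows "cmod t \<le> 1 / (1 - cmod z)"
proof -
  obtain c where c: "\<And>i. c i \<in> D" "(\<lambda>i. of_int (c i) * z ^ i) sums t"
    using assms(3) by (auto simp: series_set_def)
  have g: "(\<lambda>i. cmod z ^ i) sums (1 / (1 - cmod z))"
    using assms(1) by (intro geometric_sums) auto
  have "norm (of_int (c i) * z ^ i) \<le> cmod z ^ i" for i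
  proof -
    have "\<bar>real_of_int (c i)\<bar> \<le> 1" using assms(2)[OF c(1)[of i]] by linarith
    then show ?thesis by (simp add: norm_mult norm_power mult_left_le_one_le)
  qed
  then have "norm (\<Sum>i. of_int (c i) * z ^ i) \<le> (\<Sum>i. cmod z ^ i)"
    using g by (intro norm_suminf_le) (auto simp: sums_iff)
  then show ?thesis using c(2) g by (simp add: sums_iff)
qed

section \<open>Existence and uniqueness of the attractor\<close>

lemma ifs_attractor_exists:
  assumes z: "z \<noteq> 0" "cmod z < 1"
  shows "\<exists>K. compact K \<and> K \<noteq> {} \<and> K = ifs_f z ` K \<union> ifs_g z ` K"
proof -
  \<comment> \<open>The radius solves \<open>cmod z * R + 2 = R\<close>; as
    \<open>cmod (1 - z) \<le> 2\<close>, both maps send the ball into itself.\<close>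
  define R where "R = 2 / (1 - cmod z)"
  define H where "H A = ifs_f z ` A \<union> ifs_g z ` A" for A
  define B where "B n = (H ^^ n) (cball 0 R)" for n
  have BS: "B (Suc n) = H (B n)" and B0: "B 0 = cball 0 R" for n by (simp_all add: B_def)
  have R: "cmod z * R + 2 = R" "0 < R" using z(2) by (simp_all add: R_def field_simps)
  have H0: "H (cball 0 R) \<subseteq> cball 0 R"
  proof -
    have 1: "cmod (z * x) \<le> cmod z * R" if "cmod x \<le> R" for x
      using that by (simp add: norm_mult mult_left_mono)
    have "cmod (z * (x - 1) + 1) \<le> R" if "cmod x \<le> R" for x
    proof -
      have "cmod (z * (x - 1) + 1) \<le> cmod (z * x) + cmod (1 - z)"
        using norm_triangle_ineq[of "z * x" "1 - z"] by (simp add: algebra_simps)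
      moreover have "cmod (1 - z) \<le> 2" using norm_triangle_ineq4[of 1 z] z(2) by simp
      ultimately show ?thesis using 1[OF that] R by linarith
    qed
    moreover have "cmod (z * x) \<le> R" if "cmod x \<le> R" for x
      using 1[OF that] R by linarith
    ultimately show ?thesis by (auto simp: H_def ifs_f_def ifs_g_def)
  qed
  have Hmono: "H A \<subseteq> H A'" if "A \<subseteq> A'" for A A' using that by (auto simp: H_def)
  have dec: "B (Suc n) \<subseteq> B n" for n
    by (induction n) (use H0 Hmono in \<open>simp_all add: B0 BS del: funpow.simps\<close>)
  have mono: "B n \<subseteq> B m" if "m \<le> n" for m n
    using that dec by (rule lift_Suc_antimono_le[rotated])
  have comp: "compact (B n)" for n
  proof (induction n)
    case (Suc n)
    have "continuous_on (B n) (ifs_f z)" "continuous_on (B n) (ifs_g z)"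
      unfolding ifs_f_def ifs_g_def by (intro continuous_intros)+
    then show ?case using Suc by (simp add: BS H_def compact_Un compact_continuous_image)
  qed (simp add: B0)
  \<comment> \<open>The limit of the nested images; it contains 0, the fixed point of
    \<open>ifs_f z\<close>.\<close>
  define L where "L = (\<Inter>n. B n)"
  have "compact L" unfolding L_def using comp by (intro compact_Inter) auto
  moreover have "0 \<in> B n" for n
  proof (induction n)
    case (Suc n)
    then have "ifs_f z 0 \<in> H (B n)" by (auto simp: H_def)
    then show ?case by (simp add: BS ifs_f_def)
  qed (use R in \<open>simp add: B0\<close>)
  then have "L \<noteq> {}" by (auto simp: L_def)
  moreover have "L = H L"
  proof
    show "H L \<subseteq> L"
    proof -
      have "H L \<subseteq> B (Suc n)" for n unfolding BS by (rule Hmono) (auto simp: L_def)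
      then show ?thesis using dec by (fastforce simp: L_def)
    qed
    show "L \<subseteq> H L"
    proof
      fix x assume x: "x \<in> L"
      have f: "ifs_f z (x / z) = x" and g: "ifs_g z ((x - 1) / z + 1) = x"
        using z(1) by (simp_all add: ifs_f_def ifs_g_def)
      have f': "y = x / z" if "ifs_f z y = x" for y using that z(1) by (auto simp: ifs_f_def)
      have g': "y = (x - 1) / z + 1" if "ifs_g z y = x" for y
        using that z(1) by (auto simp: ifs_g_def)
      \<comment> \<open>Both maps are injective. If the two candidate preimages of \<open>x\<close>
        dropped out at stages \<open>m\<close> and \<open>n\<close>, then \<open>x\<close> would
        drop out just after stage \<open>max m n\<close>.\<close>
      show "x \<in> H L"
      proof (rule ccontr)
        assume "x \<notin> H L"
        then have "x / z \<notin> L" "(x - 1) / z + 1 \<notin> L"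
          using f g by (metis H_def UnCI imageI)+
        then obtain m n where mn: "x / z \<notin> B m" "(x - 1) / z + 1 \<notin> B n" by (auto simp: L_def)
        have "x \<in> H (B (max m n))" using x by (auto simp: L_def simp flip: BS)
        then have "x / z \<in> B (max m n) \<or> (x - 1) / z + 1 \<in> B (max m n)"
          using f' g' by (fastforce simp: H_def)
        then show False using mn mono[of m "max m n"] mono[of n "max m n"] by auto
      qed
    qed
  qed
  ultimately show ?thesis by (auto simp: H_def)
qed

text \<open>In the coordinate \<open>s\<close> with \<open>x = (1 - z) * s\<close> the two maps
  become \<open>s \<mapsto> z * s\<close> and \<open>s \<mapsto> 1 + z * s\<close>, which prepend
  the digits 0 and 1. This also yields uniqueness of the attractor.\<close>

lemma ifs_invariant_eq_series_set:
  assumes z: "z \<noteq> 0" "cmod z < 1"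
    and K: "compact K" "K \<noteq> {}" "K = ifs_f z ` K \<union> ifs_g z ` K"
  shows "K = (\<lambda>s. (1 - z) * s) ` series_set {0, 1} z"
proof -
  have z1: "1 - z \<noteq> 0" using z(2) by auto
  define L where "L = (\<lambda>x. x / (1 - z)) ` K"
  have "compact L" unfolding L_def using z1
    by (intro compact_continuous_image continuous_intros K(1)) auto
  have KL: "K = (\<lambda>s. (1 - z) * s) ` L" using z1 by (auto simp: L_def image_image)
  have mem: "s \<in> L \<longleftrightarrow> (1 - z) * s \<in> K" for s
  proof
    assume "(1 - z) * s \<in> K"
    then have "(1 - z) * s / (1 - z) \<in> L" unfolding L_def by (rule imageI)
    then show "s \<in> L" using z1 by simp
  qed (use z1 in \<open>auto simp: L_def\<close>)
  have f: "ifs_f z ((1 - z) * s) = (1 - z) * (of_int 0 + z * s)" for s by (simp add: ifs_f_def)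
  have g: "ifs_g z ((1 - z) * s) = (1 - z) * (of_int 1 + z * s)" for s
    by (simp add: ifs_g_def algebra_simps)
  have "series_set {0, 1} z \<subseteq> L"
  proof (rule series_set_subset_closed[OF z])
    show "closed L" using \<open>compact L\<close> by (rule compact_imp_closed)
    show "L \<noteq> {}" using K(2) by (auto simp: L_def)
    fix t and d :: int assume t: "t \<in> L" and d: "d \<in> {0, 1}"
    have "ifs_f z ((1 - z) * t) \<in> K" "ifs_g z ((1 - z) * t) \<in> K"
      using t K(3) mem by blast+
    then show "of_int d + z * t \<in> L" using d f g mem by auto
  qed
  moreover have "L \<subseteq> series_set {0, 1} z"
  proof (rule series_set_coinduct[OF z])
    show "bounded L" using \<open>compact L\<close> by (rule compact_imp_bounded)
    fix t assume "t \<in> L"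
    then have "(1 - z) * t \<in> ifs_f z ` K \<union> ifs_g z ` K" using mem K(3) by blast
    then obtain s where s: "s \<in> L"
      "(1 - z) * t = ifs_f z ((1 - z) * s) \<or> (1 - z) * t = ifs_g z ((1 - z) * s)"
      using KL by blast
    then have "t = of_int 0 + z * s \<or> t = of_int 1 + z * s" unfolding f g using z1 by auto
    then show "\<exists>d\<in>{0, 1}. (t - of_int d) / z \<in> L" using s(1) z(1) by auto
  qed
  ultimately show ?thesis using KL by simp
qed

lemma Lambda_invariant:
  assumes "z \<noteq> 0" "cmod z < 1"
  shows "compact (Lambda z) \<and> Lambda z \<noteq> {} \<and> Lambda z = ifs_f z ` Lambda z \<union> ifs_g z ` Lambda z"
proof -
  have "\<exists>!K. compact K \<and> K \<noteq> {} \<and> K = ifs_f z ` K \<union> ifs_g z ` K"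
    using ifs_attractor_exists[OF assms] ifs_invariant_eq_series_set[OF assms]
      by (metis (no_types, lifting))
  then show ?thesis unfolding Lambda_def by (rule theI')
qed

lemma Lambda_eq_series_set:
  assumes "z \<noteq> 0" "cmod z < 1"
  shows "Lambda z = (\<lambda>s. (1 - z) * s) ` series_set {0, 1} z"
  using Lambda_invariant[OF assms] by (elim conjE) (rule ifs_invariant_eq_series_set[OF assms])

section \<open>Connectedness and fullness of the attractor\<close>

lemma dist_ifs: "dist (ifs_f z x) (ifs_f z y) = cmod z * dist x y"
  "dist (ifs_g z x) (ifs_g z y) = cmod z * dist x y"
  using norm_mult[of z "x - y"] by (simp_all add: ifs_f_def ifs_g_def dist_norm algebra_simps)

text \<open>Disjoint halves are a closed separation. If the halves meet, a separation of the
  attractor with a positive gap pulls back under each map to a separation with a larger gap, until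
  the gap exceeds the diameter.\<close>

lemma connected_Lambda_iff:
  assumes z: "z \<noteq> 0" "cmod z < 1"
  shows "connected (Lambda z) \<longleftrightarrow> ifs_f z ` Lambda z \<inter> ifs_g z ` Lambda z \<noteq> {}"
proof -
  let ?L = "Lambda z"
  have comp: "compact ?L" and ne: "?L \<noteq> {}" and inv: "?L = ifs_f z ` ?L \<union> ifs_g z ` ?L"
    using Lambda_invariant[OF z] by blast+
  have cl: "closed (ifs_f z ` ?L)" "closed (ifs_g z ` ?L)"
    unfolding ifs_f_def ifs_g_def
    by (intro compact_imp_closed compact_continuous_image continuous_intros comp)+
  show ?thesis
  proof
    assume con: "connected ?L"
    show "ifs_f z ` ?L \<inter> ifs_g z ` ?L \<noteq> {}"
    proof
      assume "ifs_f z ` ?L \<inter> ifs_g z ` ?L = {}"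
      then have "ifs_f z ` ?L \<inter> ?L = {} \<or> ifs_g z ` ?L \<inter> ?L = {}"
        by (intro connected_closedD[OF con _ _ cl] equalityD1[OF inv]) blast
      moreover have "ifs_f z ` ?L \<subseteq> ?L" "ifs_g z ` ?L \<subseteq> ?L"
        using equalityD2[OF inv] by blast+
      ultimately show False using ne by blast
    qed
  next
    assume meet: "ifs_f z ` ?L \<inter> ifs_g z ` ?L \<noteq> {}"
    obtain R where R: "0 < R" "\<And>x y. x \<in> ?L \<Longrightarrow> y \<in> ?L \<Longrightarrow> dist x y < R"
    proof -
      obtain e where e: "\<And>x y. x \<in> ?L \<Longrightarrow> y \<in> ?L \<Longrightarrow> dist x y \<le> e"
        using compact_imp_bounded[OF comp] bounded_two_points by metis
      show ?thesis
        by (rule that[of "max 0 e + 1"]) (use e in \<open>force+\<close>)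
    qed
    \<comment> \<open>By the induction hypothesis for the pulled back sets each half lies in
      \<open>A\<close> or in \<open>B\<close>, and meeting halves lie in the same one.\<close>
    have chain: "A = {} \<or> B = {}"
      if "A \<union> B = ?L" "\<And>x y. x \<in> A \<Longrightarrow> y \<in> B \<Longrightarrow> cmod z ^ n * R \<le> dist x y" for A B n
      using that
    proof (induction n arbitrary: A B)
      case 0
      show ?case
      proof (rule ccontr)
        assume "\<not> (A = {} \<or> B = {})"
        then obtain x y where xy: "x \<in> A" "y \<in> B" by blast
        then have "dist x y < R" using R(2) 0(1) by blast
        then show False using 0(2)[OF xy] by simp
      qed
    next
      case (Suc n)
      have split: "h ` ?L \<subseteq> A \<or> h ` ?L \<subseteq> B"
        if h: "h ` ?L \<subseteq> ?L" "\<And>x y. dist (h x) (h y) = cmod z * dist x y" for h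
      proof -
        have "{x \<in> ?L. h x \<in> A} = {} \<or> {x \<in> ?L. h x \<in> B} = {}"
        proof (rule Suc.IH)
          show "{x \<in> ?L. h x \<in> A} \<union> {x \<in> ?L. h x \<in> B} = ?L"
            using h(1) Suc.prems(1) by blast
          fix x y assume "x \<in> {x \<in> ?L. h x \<in> A}" "y \<in> {x \<in> ?L. h x \<in> B}"
          then have "cmod z ^ Suc n * R \<le> cmod z * dist x y"
            using Suc.prems(2)[of "h x" "h y"] h(2) by simp
          then show "cmod z ^ n * R \<le> dist x y"
            using z(1) by (simp add: mult.assoc)
        qed
        then show ?thesis using h(1) Suc.prems(1) by blast
      qed
      have disj: "A \<inter> B = {}"
      proof (rule ccontr)
        assume "A \<inter> B \<noteq> {}"
        then obtain x where "x \<in> A" "x \<in> B" by blast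
        then show False
          using Suc.prems(2)[of x x] z(1) R(1) by (simp add: mult_le_0_iff power_le_zero_eq)
      qed
      have "ifs_f z ` ?L \<subseteq> A \<or> ifs_f z ` ?L \<subseteq> B" "ifs_g z ` ?L \<subseteq> A \<or> ifs_g z ` ?L \<subseteq> B"
        using split[of "ifs_f z"] split[of "ifs_g z"] inv dist_ifs by blast+
      then have "ifs_f z ` ?L \<union> ifs_g z ` ?L \<subseteq> A \<or> ifs_f z ` ?L \<union> ifs_g z ` ?L \<subseteq> B"
        using meet disj by blast
      then have "?L \<subseteq> A \<or> ?L \<subseteq> B" unfolding inv[symmetric] .
      then show ?case using disj Suc.prems(1) by blast
    qed
    show "connected ?L"
      unfolding connected_closed
    proof (rule notI, elim exE conjE)
      fix A B assume AB: "closed A" "closed B" "?L \<subseteq> A \<union> B" "A \<inter> B \<inter> ?L = {}"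
        "A \<inter> ?L \<noteq> {}" "B \<inter> ?L \<noteq> {}"
      have "compact (A \<inter> ?L)" "closed (B \<inter> ?L)"
        using AB comp by (auto simp: closed_Int_compact compact_imp_closed closed_Int)
      then obtain d where d: "0 < d" "\<And>x y. x \<in> A \<inter> ?L \<Longrightarrow> y \<in> B \<inter> ?L \<Longrightarrow> d \<le> dist x y"
        using separate_compact_closed[of "A \<inter> ?L" "B \<inter> ?L"] AB(4) by blast
      have "(\<lambda>n. cmod z ^ n * R) \<longlonglongrightarrow> 0 * R"
        using z(2) by (intro tendsto_mult tendsto_const LIMSEQ_power_zero) auto
      then have "\<forall>\<^sub>F n in sequentially. cmod z ^ n * R < d"
        using d(1) by (intro order_tendstoD(2)[where y = 0]) auto
      then obtain n where "cmod z ^ n * R < d" by (auto simp: eventually_sequentially)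
      then have "A \<inter> ?L = {} \<or> B \<inter> ?L = {}"
        using d(2) AB(3) by (intro chain[of _ _ n]) (auto intro: less_imp_le order_trans)
      then show False using AB by blast
    qed
  qed
qed

text \<open>Keeps both expansions instead of only their difference: the difference gives an
  expansion of \<open>-1 / z\<close>, and the sum later determines the common point.\<close>

lemma ifs_images_meet:
  assumes z: "z \<noteq> 0" "cmod z < 1" and x: "x \<in> ifs_f z ` Lambda z \<inter> ifs_g z ` Lambda z"
  shows "\<exists>a b s. (\<forall>i. a i \<in> {0, 1 :: int}) \<and> (\<forall>i. b i \<in> {0, 1 :: int}) \<and>
    (\<lambda>i. of_int (a i) * z ^ i) sums s \<and> (\<lambda>i. of_int (b i) * z ^ i) sums (s - 1 / z) \<and>
    x = z * (1 - z) * s"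
proof -
  have z1: "1 - z \<noteq> 0" using z(2) by auto
  obtain s t where st: "s \<in> series_set {0, 1} z" "t \<in> series_set {0, 1} z"
    "x = ifs_f z ((1 - z) * s)" "x = ifs_g z ((1 - z) * t)"
    using x unfolding Lambda_eq_series_set[OF z] by blast
  then have "z * (1 - z) * s = (1 - z) * (1 + z * t)"
    by (simp add: ifs_f_def ifs_g_def algebra_simps)
  then have "(1 - z) * (z * s) = (1 - z) * (1 + z * t)" by (simp add: mult_ac)
  then have "z * s = 1 + z * t" using z1 by simp
  then have t: "t = s - 1 / z" using z(1) by (simp add: field_simps)
  obtain a where a: "\<forall>i. a i \<in> {0, 1 :: int}" "(\<lambda>i. of_int (a i) * z ^ i) sums s"
    using st(1) by (auto simp: series_set_def)
  obtain b where b: "\<forall>i. b i \<in> {0, 1 :: int}" "(\<lambda>i. of_int (b i) * z ^ i) sums (s - 1 / z)"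
    using st(2) by (auto simp: series_set_def t)
  have "x = z * (1 - z) * s" using st(3) by (simp add: ifs_f_def)
  then show ?thesis using a b by (intro exI conjI)
qed

lemma ifs_images_meet_iff:
  assumes z: "z \<noteq> 0" "cmod z < 1"
  shows "ifs_f z ` Lambda z \<inter> ifs_g z ` Lambda z \<noteq> {} \<longleftrightarrow> -1 / z \<in> series_set {-1, 0, 1} z"
proof
  assume "ifs_f z ` Lambda z \<inter> ifs_g z ` Lambda z \<noteq> {}"
  then obtain x where "x \<in> ifs_f z ` Lambda z \<inter> ifs_g z ` Lambda z" by blast
  from ifs_images_meet[OF z this] obtain a b :: "nat \<Rightarrow> int" and s where
    ab: "\<forall>i. a i \<in> {0, 1}" "\<forall>i. b i \<in> {0, 1}"
    "(\<lambda>i. of_int (a i) * z ^ i) sums s" "(\<lambda>i. of_int (b i) * z ^ i) sums (s - 1 / z)"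
    by (elim exE conjE)
  have "(\<lambda>i. of_int (b i - a i) * z ^ i) sums (-1 / z)"
    using sums_diff[OF ab(4,3)] by (simp add: left_diff_distrib)
  moreover have "b i - a i \<in> {-1, 0, 1}" for i
    using ab(1,2)[rule_format, of i] by auto
  ultimately show "-1 / z \<in> series_set {-1, 0, 1} z"
    unfolding series_set_def by (intro CollectI exI[of _ "\<lambda>i. b i - a i"]) auto
next
  assume "-1 / z \<in> series_set {-1, 0, 1} z"
  then obtain c where c: "\<And>i. c i \<in> {-1, 0, 1}" "(\<lambda>i. of_int (c i) * z ^ i) sums (-1 / z)"
    by (auto simp: series_set_def)
  \<comment> \<open>The negative and positive parts of the digits, so that
    \<open>b i - a i = c i\<close>.\<close>
  define a b where "a i = max (- c i) 0" and "b i = max (c i) 0" for i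
  have ab: "a i \<in> {0, 1}" "b i \<in> {0, 1}" "b i - a i = c i" for i
    using c(1)[of i] by (auto simp: a_def b_def)
  have "summable (\<lambda>i. of_int (a i) * z ^ i)"
  proof (rule summable_comparison_test'[where N = 0])
    show "summable (\<lambda>i. cmod z ^ i)" using z(2) by (simp add: summable_geometric)
    show "norm (of_int (a i) * z ^ i) \<le> cmod z ^ i" for i
      using ab(1)[of i] by (auto simp: norm_mult norm_power)
  qed
  then obtain s where s: "(\<lambda>i. of_int (a i) * z ^ i) sums s" by (auto simp: summable_def)
  have "(\<lambda>i. of_int (b i) * z ^ i) sums (-1 / z + s)"
    using sums_add[OF c(2) s] unfolding ab(3)[symmetric] by (simp add: algebra_simps)
  then have "s \<in> series_set {0, 1} z" "-1 / z + s \<in> series_set {0, 1} z"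
    using s ab(1,2) unfolding series_set_def by blast+
  then have "ifs_f z ((1 - z) * s) \<in> ifs_f z ` Lambda z"
    "ifs_g z ((1 - z) * (-1 / z + s)) \<in> ifs_g z ` Lambda z"
    unfolding Lambda_eq_series_set[OF z] by blast+
  moreover have "ifs_f z ((1 - z) * s) = ifs_g z ((1 - z) * (-1 / z + s))"
    using z(1) by (simp add: ifs_f_def ifs_g_def field_simps)
  ultimately show "ifs_f z ` Lambda z \<inter> ifs_g z ` Lambda z \<noteq> {}" by (metis IntI empty_iff)
qed

lemma Mset_iff:
  "z \<in> Mset \<longleftrightarrow> z \<noteq> 0 \<and> cmod z < 1 \<and> -1 / z \<in> series_set {-1, 0, 1} z"
proof (cases "z \<noteq> 0 \<and> cmod z < 1")
  case True
  then show ?thesis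
    using connected_Lambda_iff[of z] ifs_images_meet_iff[of z]
    by (simp add: Mset_def punctured_disc_def)
qed (auto simp: Mset_def punctured_disc_def)

text \<open>If two points off \<open>\<Lambda>\<close> were separated by \<open>\<Lambda>\<close>, then by Janiszewski's theorem they would be
  separated by one of its two halves, and inductively by arbitrarily small pieces of \<open>\<Lambda>\<close>.\<close>

lemma full_Lambda:
  assumes z: "z \<noteq> 0" "cmod z < 1"
    and meet: "connected (ifs_f z ` Lambda z \<inter> ifs_g z ` Lambda z)"
  shows "full (Lambda z)"
proof -
  let ?L = "Lambda z"
  have comp: "compact ?L" and inv: "?L = ifs_f z ` ?L \<union> ifs_g z ` ?L"
    using Lambda_invariant[OF z] by blast+
  have f: "(\<lambda>x. a * x + b) ` ifs_f z ` ?L = (\<lambda>x. (a * z) * x + b) ` ?L" for a b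
    by (simp add: image_image ifs_f_def mult.assoc)
  have g: "(\<lambda>x. a * x + b) ` ifs_g z ` ?L = (\<lambda>x. (a * z) * x + (a * (1 - z) + b)) ` ?L" for a b
    unfolding image_image ifs_g_def by (intro image_cong refl) (simp add: algebra_simps)
  have piece: "\<exists>a b. a \<noteq> 0 \<and> cmod a = cmod z ^ n \<and> (\<lambda>x. a * x + b) ` ?L \<subseteq> ?L \<and>
      \<not> connected_component (- (\<lambda>x. a * x + b) ` ?L) u v"
    if "\<not> connected_component (- ?L) u v" for u v n
  proof (induction n)
    case 0
    show ?case by (rule exI[of _ 1], rule exI[of _ 0]) (use that in simp)
  next
    case (Suc n)
    then obtain a b where ab: "a \<noteq> 0" "cmod a = cmod z ^ n" "(\<lambda>x. a * x + b) ` ?L \<subseteq> ?L"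
      "\<not> connected_component (- (\<lambda>x. a * x + b) ` ?L) u v" by blast
    let ?h = "\<lambda>x. a * x + b"
    have inj: "inj ?h" using ab(1) by (auto simp: inj_def)
    have un: "?h ` ?L = ?h ` ifs_f z ` ?L \<union> ?h ` ifs_g z ` ?L"
      by (subst inv) (rule image_Un)
    have "\<not> connected_component (- ?h ` ifs_f z ` ?L) u v \<or> \<not> connected_component (- ?h ` ifs_g z ` ?L) u v"
    proof (rule ccontr)
      assume "\<not> ?thesis"
      then have cc: "connected_component (- ?h ` ifs_f z ` ?L) u v"
        "connected_component (- ?h ` ifs_g z ` ?L) u v" by blast+
      have c: "compact (?h ` ifs_f z ` ?L)" "compact (?h ` ifs_g z ` ?L)"
        unfolding f g by (intro compact_continuous_image continuous_intros comp)+
      have "connected (?h ` (ifs_f z ` ?L \<inter> ifs_g z ` ?L))"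
        by (intro connected_continuous_image continuous_intros meet)
      then have "connected (?h ` ifs_f z ` ?L \<inter> ?h ` ifs_g z ` ?L)"
        using image_Int[OF inj] by simp
      then have "connected_component (- (?h ` ifs_f z ` ?L \<union> ?h ` ifs_g z ` ?L)) u v"
        by (rule Janiszewski[OF c(1) compact_imp_closed[OF c(2)] _ cc])
      then show False using ab(4) un by simp
    qed
    moreover have "?h ` ifs_f z ` ?L \<subseteq> ?L" "?h ` ifs_g z ` ?L \<subseteq> ?L"
      using ab(3) un by blast+
    ultimately show ?case
      unfolding f g
    proof (elim disjE)
      assume "\<not> connected_component (- (\<lambda>x. a * z * x + b) ` ?L) u v"
        "(\<lambda>x. a * z * x + b) ` ?L \<subseteq> ?L"
      then show ?thesis using ab z(1)
        by (intro exI[of _ "a * z"] exI[of _ b]) (simp add: norm_mult)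
    next
      assume "\<not> connected_component (- (\<lambda>x. a * z * x + (a * (1 - z) + b)) ` ?L) u v"
        "(\<lambda>x. a * z * x + (a * (1 - z) + b)) ` ?L \<subseteq> ?L"
      then show ?thesis using ab z(1)
        by (intro exI[of _ "a * z"] exI[of _ "a * (1 - z) + b"]) (simp add: norm_mult)
    qed
  qed
  show ?thesis
    unfolding full_def connected_iff_connected_component
  proof (intro ballI)
    fix u v assume uv: "u \<in> - ?L" "v \<in> - ?L"
    show "connected_component (- ?L) u v"
    proof (rule ccontr)
      assume sep: "\<not> connected_component (- ?L) u v"
      have "open (- ?L)" using comp by (simp add: compact_imp_closed open_Compl)
      then obtain e1 e2 where e: "0 < e1" "0 < e2" "ball u e1 \<subseteq> - ?L" "ball v e2 \<subseteq> - ?L"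
        using uv by (meson openE)
      define e where "e = min e1 e2"
      obtain B where B: "\<And>x y. x \<in> ?L \<Longrightarrow> y \<in> ?L \<Longrightarrow> dist x y \<le> B"
        using compact_imp_bounded[OF comp] bounded_two_points by metis
      have "(\<lambda>n. cmod z ^ n * B) \<longlonglongrightarrow> 0 * B"
        using z(2) by (intro tendsto_mult tendsto_const LIMSEQ_power_zero) auto
      then have "\<forall>\<^sub>F n in sequentially. cmod z ^ n * B < e"
        using e by (intro order_tendstoD(2)[where y = 0]) (auto simp: e_def)
      then obtain n where n: "cmod z ^ n * B < e" by (auto simp: eventually_sequentially)
      obtain a b where ab: "a \<noteq> 0" "cmod a = cmod z ^ n" "(\<lambda>x. a * x + b) ` ?L \<subseteq> ?L"
        "\<not> connected_component (- (\<lambda>x. a * x + b) ` ?L) u v"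
        using piece[OF sep] by blast
      obtain x where x: "x \<in> ?L" using Lambda_invariant[OF z] by blast
      define y where "y = a * x + b"
      have y: "y \<in> ?L" using ab(3) x by (auto simp: y_def)
      let ?C = "cball y (cmod z ^ n * B)"
      have sub: "(\<lambda>x. a * x + b) ` ?L \<subseteq> ?C"
      proof (rule image_subsetI)
        fix x' assume "x' \<in> ?L"
        then have "cmod a * cmod (x - x') \<le> cmod a * B"
          using B[OF x] by (intro mult_left_mono) (auto simp: dist_norm)
        then show "a * x' + b \<in> ?C"
          using norm_mult[of a "x - x'"] ab(2) by (simp add: y_def dist_norm algebra_simps)
      qed
      \<comment> \<open>The points \<open>u\<close> and \<open>v\<close> are farther from
        \<open>y\<close> than the radius of \<open>?C\<close>, so they lie in the connected
        complement of that disc.\<close>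
      have "y \<notin> ball u e1" "y \<notin> ball v e2" using e y by blast+
      then have "u \<in> - ?C" "v \<in> - ?C" using n by (auto simp: e_def dist_commute)
      moreover have "connected (- ?C)"
        by (rule connected_complement_bounded_convex) auto
      ultimately have "connected_component (- ?C) u v"
        unfolding connected_iff_connected_component by blast
      then have "connected_component (- (\<lambda>x. a * x + b) ` ?L) u v"
        by (rule connected_component_mono[THEN subsetD, unfolded mem_Collect_eq, rotated]) (use sub in auto)
      then show False using ab(4) by blast
    qed
  qed
qed

subsection \<open>Disc arithmetic\<close>

text \<open>Discs are handled in fixed-point arithmetic with unit \<open>2\<^sup>-\<^sup>2\<^sup>0\<close>: \<open>(x, y, r)\<close> stands for the
  closed disc of radius \<open>r / 2\<^sup>2\<^sup>0\<close> about \<open>(x + \<i> y) / 2\<^sup>2\<^sup>0\<close>. In \<open>disc_step\<close>, which encloses \<open>t \<mapsto>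
  (t - d) / z\<close> for all \<open>z\<close> near \<open>\<omega>\<close>, the point \<open>955536 - 1334688 \<i>\<close> is \<open>2\<^sup>2\<^sup>0 / \<omega>\<close> with error at
  most 54, \<open>1641651\<close> bounds \<open>2\<^sup>2\<^sup>0 / \<bar>z\<bar>\<close>, and the final 4 pays for the roundings.\<close>

definition disc_step :: "int \<Rightarrow> int \<times> int \<times> int \<Rightarrow> int \<times> int \<times> int" where
  "disc_step d = (\<lambda>(x, y, r). let c = x - d * 1048576 in
     ((c * 955536 + y * 1334688) div 1048576, (y * 955536 - c * 1334688) div 1048576,
      r * 1641651 div 1048576 + (\<bar>c\<bar> + \<bar>y\<bar>) * 54 div 1048576 + 4))"

text \<open>\<open>2915042 / 2\<^sup>2\<^sup>0\<close> is slightly more than \<open>1 / (1 - \<bar>\<omega>\<bar>)\<close>, which bounds the difference set.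
  The nested conditionals keep the evaluation lazy.\<close>

definition leaves_bound :: "int \<times> int \<times> int \<Rightarrow> bool" where
  "leaves_bound = (\<lambda>(x, y, r). (2915042 + r) * (2915042 + r) < x * x + y * y)"

primrec escapes :: "nat \<Rightarrow> int \<times> int \<times> int \<Rightarrow> bool" where
  "escapes 0 b = leaves_bound b"
| "escapes (Suc n) b = (if leaves_bound b then True
     else if escapes n (disc_step (-1) b)
       then if escapes n (disc_step 0 b) then escapes n (disc_step 1 b) else False
       else False)"

declare escapes.simps(2) [simp del]

primrec forced :: "int list \<Rightarrow> int \<times> int \<times> int \<Rightarrow> bool" where
  "forced [] b \<longleftrightarrow> True"
| "forced (d # w) b \<longleftrightarrow>
     list_all (\<lambda>e.
       if e = d then True else escapes 20 (disc_step e b)) [-1, 0, 1] \<and> forced w (disc_step d b)"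

text \<open>A certificate subdivides a square into quarters. Each \<open>Leaf w\<close> square is carried into a
  fixed rectangle by the inverse branches with digits \<open>w\<close>, each \<open>Skip\<close> square misses the region to
  be covered. Certificates are written as the list of their nodes in preorder, with \<open>[2]\<close> for an
  inner node and \<open>[]\<close> for \<open>Skip\<close>.\<close>

datatype cert = Skip | Leaf "int list" | Node cert cert cert cert

primrec push :: "int list \<Rightarrow> cert list \<Rightarrow> cert list" where
  "push [] s = Skip # s"
| "push (d # w) s = (if d = 2
     then case s of a # b # c # e # s' \<Rightarrow> Node a b c e # s' | _ \<Rightarrow> s
     else Leaf (d # w) # s)"

definition cert_of :: "int list list \<Rightarrow> cert" where
  "cert_of ts = hd (foldr push ts [])"

definition inK :: "int \<times> int \<times> int \<Rightarrow> bool" where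
  "inK = (\<lambda>(x, y, r). \<bar>x\<bar> + r \<le> 1373529 \<and> \<bar>y\<bar> + r \<le> 523239)"

primrec lands :: "int list \<Rightarrow> int \<times> int \<times> int \<Rightarrow> bool" where
  "lands [] b \<longleftrightarrow> inK b"
| "lands (d # w) b \<longleftrightarrow> \<bar>d\<bar> \<le> 1 \<and> lands w (disc_step d b)"

text \<open>An upper bound for the half-diagonal of a square of half-side \<open>h\<close>: 1.415
  exceeds the square root of 2, and the 1 pays for the floor.\<close>

definition diag :: "int \<Rightarrow> int" where
  "diag h = h * 1415 div 1000 + 1"

text \<open>\<open>P\<close> tests the squares that may be skipped. The bound 11 on word lengths
  later makes the set of intermediate points bounded; the parity test ensures that the four quarters
  cover the square.\<close>

primrec check :: "(int \<Rightarrow> int \<Rightarrow> int \<Rightarrow> bool) \<Rightarrow> cert \<Rightarrow> int \<Rightarrow> int \<Rightarrow> int \<Rightarrow> bool" where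
  "check P Skip x y h \<longleftrightarrow> P x y h"
| "check P (Leaf w) x y h \<longleftrightarrow> w \<noteq> [] \<and> length w \<le> 11 \<and> lands w (x, y, diag h)"
| "check P (Node a b c d) x y h \<longleftrightarrow> (let k = h div 2 in 2 * k = h \<and>
     check P a (x - k) (y - k) k \<and> check P b (x + k) (y - k) k \<and>
     check P c (x - k) (y + k) k \<and> check P d (x + k) (y + k) k)"

text \<open>The radius is twice the tolerance allowed for \<omega>, so it includes every parameter
  within 1/100000 of \<omega>.\<close>

definition near :: "complex \<Rightarrow> bool" where
  "near z \<longleftrightarrow> cmod (z - Complex (371859 / 1000000) (519411 / 1000000)) \<le> (2 / 100000)"

definition grid :: "int \<Rightarrow> int \<Rightarrow> complex" where
  "grid x y = Complex (of_int x / 1048576) (of_int y / 1048576)"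

definition disc :: "int \<times> int \<times> int \<Rightarrow> complex set" where
  "disc = (\<lambda>(x, y, r). cball (grid x y) (of_int r / 1048576))"

primrec run :: "complex \<Rightarrow> int list \<Rightarrow> complex \<Rightarrow> complex" where
  "run z [] t = t"
| "run z (d # w) t = run z w ((t - of_int d) / z)"

section \<open>Numerical bounds near \<omega> and soundness of the disc computations\<close>

lemma cmod_le_iff: "0 \<le> r \<Longrightarrow> cmod (Complex a b) \<le> r \<longleftrightarrow> a\<^sup>2 + b\<^sup>2 \<le> r\<^sup>2"
  using real_sqrt_le_iff[of "a\<^sup>2 + b\<^sup>2" "r\<^sup>2"] by (simp add: complex_norm)

lemma cmod_ge_iff: "0 \<le> r \<Longrightarrow> r \<le> cmod (Complex a b) \<longleftrightarrow> r\<^sup>2 \<le> a\<^sup>2 + b\<^sup>2"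
  using real_sqrt_le_iff[of "r\<^sup>2" "a\<^sup>2 + b\<^sup>2"] by (simp add: complex_norm)

lemma near_norm:
  assumes "near z"
  shows "(6387 / 10000) \<le> cmod z" "cmod z \<le> (6389 / 10000)" "z \<noteq> 0" "cmod z < 1" "(81 / 100) \<le> cmod (1 - z)"
proof -
  let ?a = "Complex (371859 / 1000000) (519411 / 1000000)"
  have a: "(63878 / 100000) \<le> cmod ?a" "cmod ?a \<le> (63882 / 100000)" "(815 / 1000) \<le> cmod (1 - ?a)"
  proof -
    have "1 - ?a = Complex (628141 / 1000000) (-(519411 / 1000000))" by (simp add: complex_eq_iff)
    then show "(815 / 1000) \<le> cmod (1 - ?a)"
      by (simp only:) (subst cmod_ge_iff, simp_all add: power2_eq_square)
    show "(63878 / 100000) \<le> cmod ?a" by (subst cmod_ge_iff) (simp_all add: power2_eq_square)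
    show "cmod ?a \<le> (63882 / 100000)" by (subst cmod_le_iff) (simp_all add: power2_eq_square)
  qed
  have d: "cmod (z - ?a) \<le> (2 / 100000)" using assms by (simp add: near_def)
  have "cmod ?a \<le> cmod z + cmod (z - ?a)" "cmod z \<le> cmod ?a + cmod (z - ?a)"
    "cmod (1 - ?a) \<le> cmod (1 - z) + cmod (z - ?a)"
    using norm_triangle_ineq4[of z "z - ?a"] norm_triangle_ineq[of ?a "z - ?a"]
      norm_triangle_ineq[of "1 - z" "z - ?a"] by simp_all
  then show "(6387 / 10000) \<le> cmod z" "cmod z \<le> (6389 / 10000)" "cmod z < 1" "(81 / 100) \<le> cmod (1 - z)"
    using a d by linarith+
  then show "z \<noteq> 0" by auto
qed

text \<open>With \<open>?V\<close> an approximate inverse of the centre, the error is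
  \<open>(1 - z * ?V) / z\<close>, and \<open>1 - z * ?V\<close> is estimated at the centre plus a
  variation in \<open>z\<close>.\<close>

lemma near_inverse:
  assumes "near z"
  shows "cmod (1 / z - grid 955536 (-1334688)) \<le> 54 / 1048576" "cmod (1 / z) \<le> 1641651 / 1048576"
proof -
  let ?a = "Complex (371859 / 1000000) (519411 / 1000000)" and ?V = "grid 955536 (-1334688)"
  have d: "cmod (z - ?a) \<le> (2 / 100000)" using assms by (simp add: near_def)
  have "(63876 / 100000) \<le> cmod z"
  proof -
    have "(63878 / 100000) \<le> cmod ?a" by (subst cmod_ge_iff) (simp_all add: power2_eq_square)
    then show ?thesis using norm_triangle_ineq4[of z "z - ?a"] d by simp
  qed
  then show inv: "cmod (1 / z) \<le> 1641651 / 1048576"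
    unfolding norm_divide by (subst divide_le_eq) auto
  have "cmod (1 - ?a * ?V) \<le> 1 / 1000000"
    using cmod_le[of "1 - ?a * ?V"] by (simp add: grid_def)
  moreover have "cmod ?V \<le> (15656 / 10000)"
    unfolding grid_def by (subst cmod_le_iff) (simp_all add: power2_eq_square)
  then have "cmod ((z - ?a) * ?V) \<le> (2 / 100000) * (15656 / 10000)"
    unfolding norm_mult using d by (intro mult_mono) auto
  ultimately have "cmod (1 - ?a * ?V - (z - ?a) * ?V) \<le> (1 / 1000000) + (2 / 100000) * (15656 / 10000)"
    using norm_triangle_ineq4[of "1 - ?a * ?V" "(z - ?a) * ?V"] by linarith
  then have le: "cmod (1 - z * ?V) * cmod (1 / z) \<le> ((1 / 1000000) + (2 / 100000) * (15656 / 10000)) * (1641651 / 1048576)"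
    using inv by (intro mult_mono) (auto simp: algebra_simps)
  have "1 / z - ?V = (1 - z * ?V) * (1 / z)"
    using near_norm(3)[OF assms] by (simp add: field_simps)
  then have "cmod (1 / z - ?V) = cmod (1 - z * ?V) * cmod (1 / z)" by (simp only: norm_mult)
  also note le
  finally show "cmod (1 / z - ?V) \<le> 54 / 1048576" by (rule order_trans) simp
qed

text \<open>The same estimate with \<open>1 - z\<close> in place of \<open>z\<close>; the grid point
  approximates \<open>1 / (1 - \<omega>)\<close>.\<close>

lemma near_fixed_point:
  assumes "near z"
  shows "cmod (1 / (1 - z) - grid 991427 819813) \<le> 40 / 1048576"
proof -
  let ?a = "Complex (371859 / 1000000) (519411 / 1000000)" and ?p = "grid 991427 819813"
  have d: "cmod (z - ?a) \<le> (2 / 100000)" using assms by (simp add: near_def)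
  have pos: "0 < cmod (1 - z)" using near_norm(5)[OF assms] by linarith
  then have z1: "1 - z \<noteq> 0" by auto
  have z2: "cmod (1 / (1 - z)) \<le> (1235 / 1000)"
    using near_norm(5)[OF assms] pos unfolding norm_divide by (simp add: divide_le_eq)
  have "cmod (1 - (1 - ?a) * ?p) \<le> 1 / 1000000"
    using cmod_le[of "1 - (1 - ?a) * ?p"] by (simp add: grid_def)
  moreover have "cmod ?p \<le> (123 / 100)"
    unfolding grid_def by (subst cmod_le_iff) (simp_all add: power2_eq_square)
  then have "cmod ((z - ?a) * ?p) \<le> (2 / 100000) * (123 / 100)"
    unfolding norm_mult using d by (intro mult_mono) auto
  ultimately have "cmod (1 - (1 - ?a) * ?p + (z - ?a) * ?p) \<le> (1 / 1000000) + (2 / 100000) * (123 / 100)"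
    using norm_triangle_ineq[of "1 - (1 - ?a) * ?p" "(z - ?a) * ?p"] by linarith
  then have le: "cmod (1 - (1 - z) * ?p) * cmod (1 / (1 - z)) \<le> ((1 / 1000000) + (2 / 100000) * (123 / 100)) * (1235 / 1000)"
    using z2 by (intro mult_mono) (auto simp: algebra_simps)
  have "1 / (1 - z) - ?p = (1 - (1 - z) * ?p) * (1 / (1 - z))"
    using z1 by (simp add: field_simps)
  then have "cmod (1 / (1 - z) - ?p) = cmod (1 - (1 - z) * ?p) * cmod (1 / (1 - z))"
    by (simp only: norm_mult)
  also note le
  finally show ?thesis by (rule order_trans) simp
qed

lemma div_bounds:
  "real_of_int (n div 1048576) \<le> of_int n / 1048576"
  "of_int n / 1048576 < real_of_int (n div 1048576) + 1"
  using floor_divide_of_int_eq[of n 1048576, where 'a = real]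
    of_int_floor_le[of "real_of_int n / 1048576"] floor_correct[of "real_of_int n / 1048576"]
  by simp_all

lemma disc_step_sound:
  assumes z: "near z" and t: "t \<in> disc b"
  shows "(t - of_int d) / z \<in> disc (disc_step d b)"
proof -
  obtain x y r where b: "b = (x, y, r)" by (cases b)
  define c where "c = x - d * 1048576"
  let ?V = "grid 955536 (-1334688)" and ?e = "1 / z" and ?s = "t - of_int d"
  let ?n = "grid ((c * 955536 + y * 1334688) div 1048576) ((y * 955536 - c * 1334688) div 1048576)"
  have "cmod (grid x y - t) \<le> of_int r / 1048576" using t by (simp add: b disc_def dist_norm)
  moreover have "grid c y = grid x y - of_int d"
    by (simp add: grid_def c_def complex_eq_iff field_simps)
  ultimately have s: "cmod (?s - grid c y) \<le> of_int r / 1048576"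
    by (simp add: norm_minus_commute)
  have r: "0 \<le> real_of_int r" using norm_ge_zero order_trans[OF _ s] by fastforce
  have c: "cmod (grid c y) \<le> (\<bar>of_int c\<bar> + \<bar>of_int y\<bar>) / 1048576"
    using cmod_le[of "grid c y"] by (simp add: grid_def add_divide_distrib)
  have A: "cmod ((?s - grid c y) * ?e) \<le> of_int r / 1048576 * (1641651 / 1048576)"
    unfolding norm_mult using s near_inverse(2)[OF z] r by (intro mult_mono) auto
  have B: "cmod (grid c y * (?e - ?V)) \<le> (\<bar>of_int c\<bar> + \<bar>of_int y\<bar>) / 1048576 * (54 / 1048576)"
    unfolding norm_mult using c near_inverse(1)[OF z] by (intro mult_mono) auto
  have C: "cmod (grid c y * ?V - ?n) \<le> 2 / 1048576"
  proof -
    have "\<bar>Re (grid c y * ?V - ?n)\<bar> \<le> 1 / 1048576" "\<bar>Im (grid c y * ?V - ?n)\<bar> \<le> 1 / 1048576"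
      using div_bounds[of "c * 955536 + y * 1334688"] div_bounds[of "y * 955536 - c * 1334688"]
      by (simp_all add: grid_def field_simps abs_le_iff)
    then show ?thesis using cmod_le[of "grid c y * ?V - ?n"] by linarith
  qed
  \<comment> \<open>The three errors: the old radius magnified, the inexact value of
    \<open>1 / z\<close> acting on the centre, and the rounding of the new centre.\<close>
  have eq: "?s / z - ?n
      = ((?s - grid c y) * ?e + grid c y * (?e - ?V)) + (grid c y * ?V - ?n)"
    by (simp add: algebra_simps diff_divide_distrib)
  have "cmod (?s / z - ?n) \<le> of_int r / 1048576 * (1641651 / 1048576)
      + (\<bar>of_int c\<bar> + \<bar>of_int y\<bar>) / 1048576 * (54 / 1048576) + 2 / 1048576"
    unfolding eq by (intro norm_triangle_mono A B C)
  also have "\<dots> = (of_int (r * 1641651) / 1048576 + of_int ((\<bar>c\<bar> + \<bar>y\<bar>) * 54) / 1048576 + 2) / 1048576"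
    by (simp add: field_simps)
  \<comment> \<open>The rounded centre costs 2 units and each of the two floors in the radius costs
    1, which makes the 4 in \<open>disc_step\<close>.\<close>
  also have "\<dots> \<le> of_int (r * 1641651 div 1048576 + (\<bar>c\<bar> + \<bar>y\<bar>) * 54 div 1048576 + 4) / 1048576"
  proof (rule divide_right_mono)
    show "of_int (r * 1641651) / 1048576 + of_int ((\<bar>c\<bar> + \<bar>y\<bar>) * 54) / 1048576 + 2
        \<le> real_of_int (r * 1641651 div 1048576 + (\<bar>c\<bar> + \<bar>y\<bar>) * 54 div 1048576 + 4)"
      using div_bounds(2)[of "r * 1641651"] div_bounds(2)[of "(\<bar>c\<bar> + \<bar>y\<bar>) * 54"]
      unfolding of_int_add[of _ 4] of_int_add[of "_ div _"] of_int_numeral by linarith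
  qed simp
  finally show ?thesis
    by (simp only: b disc_step_def c_def Let_def disc_def prod.case mem_cball dist_norm
        norm_minus_commute[of "grid _ _"])
qed

lemma leaves_bound_sound:
  assumes z: "near z" and t: "t \<in> disc b" and f: "leaves_bound b"
  shows "t \<notin> series_set {-1, 0, 1} z"
proof
  assume "t \<in> series_set {-1, 0, 1} z"
  then have "cmod t \<le> 1 / (1 - cmod z)"
    using near_norm(4)[OF z] by (intro series_set_norm_le) auto
  also have "\<dots> \<le> 2915042 / 1048576" using near_norm(2)[OF z] by (simp add: field_simps)
  finally have t': "cmod t \<le> 2915042 / 1048576" .
  obtain x y r where b: "b = (x, y, r)" by (cases b)
  have r: "cmod (grid x y - t) \<le> of_int r / 1048576" using t by (simp add: b disc_def dist_norm)
  then have r0: "0 \<le> real_of_int r" using norm_ge_zero order_trans[OF _ r] by fastforce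
  have "cmod (grid x y) \<le> (2915042 + of_int r) / 1048576"
    using norm_triangle_ineq[of "grid x y - t" t] r t' by (simp add: add_divide_distrib)
  then have "(of_int x / 1048576)\<^sup>2 + (of_int y / 1048576)\<^sup>2 \<le> ((2915042 + real_of_int r) / 1048576)\<^sup>2"
    using r0 unfolding grid_def by (subst (asm) cmod_le_iff) auto
  then have "real_of_int (x * x + y * y) \<le> of_int ((2915042 + r) * (2915042 + r))"
    by (simp add: power2_eq_square field_simps)
  then show False using f unfolding of_int_le_iff by (simp add: b leaves_bound_def)
qed

lemma escapes_sound:
  assumes z: "near z"
  shows "t \<in> disc b \<Longrightarrow> escapes n b \<Longrightarrow> t \<notin> series_set {-1, 0, 1} z"
proof (induction n arbitrary: t b)
  case 0
  then show ?case using leaves_bound_sound[OF z] by simp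
next
  case (Suc n)
  show ?case
  proof (cases "leaves_bound b")
    case False
    then have "(t - of_int d) / z \<notin> series_set {-1, 0, 1} z" if "d \<in> {-1, 0, 1}" for d
      using that Suc.prems(2)
      by (intro Suc.IH[OF disc_step_sound[OF z Suc.prems(1)]]) (auto simp: escapes.simps(2) split: if_splits)
    then show ?thesis using series_set_uncons near_norm(3)[OF z] by blast
  qed (use leaves_bound_sound[OF z] Suc.prems in blast)
qed

text \<open>Any other digit would put the remainder into a disc that escapes. The statement concerns
  a given expansion, not just membership, because the digits themselves are needed to identify the
  overlap of the halves.\<close>

lemma forced_sound:
  assumes z: "near z"
  shows "t \<in> disc b \<Longrightarrow> forced w b \<Longrightarrow> \<forall>i. c i \<in> {-1, 0, 1} \<Longrightarrow>
    (\<lambda>i. of_int (c i) * z ^ i) sums t \<Longrightarrow>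
    (\<forall>i < length w. c i = w ! i) \<and> (\<lambda>i. of_int (c (i + length w)) * z ^ i) sums run z w t"
proof (induction w arbitrary: t b c)
  case (Cons d w)
  have s: "(\<lambda>i. of_int (c (Suc i)) * z ^ i) sums ((t - of_int (c 0)) / z)"
    using sums_shift[OF near_norm(3)[OF z]] Cons.prems(4) by blast
  then have mem: "(t - of_int (c 0)) / z \<in> series_set {-1, 0, 1} z"
    using Cons.prems(3) unfolding series_set_def by (intro CollectI exI[of _ "\<lambda>i. c (Suc i)"]) simp
  have c0: "c 0 = d"
  proof (rule ccontr)
    assume "c 0 \<noteq> d"
    moreover have "c 0 \<in> {-1, 0, 1}" using Cons.prems(3) by blast
    ultimately have "escapes 20 (disc_step (c 0) b)" using Cons.prems(2) by (auto split: if_splits)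
    then show False using escapes_sound[OF z disc_step_sound[OF z Cons.prems(1)]] mem by blast
  qed
  have "(\<forall>i < length w. c (Suc i) = w ! i) \<and>
      (\<lambda>i. of_int (c (Suc (i + length w))) * z ^ i) sums run z w ((t - of_int d) / z)"
    by (rule Cons.IH[OF disc_step_sound[OF z Cons.prems(1)], of d "\<lambda>i. c (Suc i)"])
      (use Cons.prems(2,3) s c0 in simp_all)
  then show ?case using c0 by (auto simp: nth_Cons split: nat.split)
qed simp

definition rectK :: "complex set" where
  "rectK = {t. \<bar>Re t\<bar> \<le> 1373529 / 1048576 \<and> \<bar>Im t\<bar> \<le> 523239 / 1048576}"

lemma lands_sound:
  assumes z: "near z"
  shows "t \<in> disc b \<Longrightarrow> lands w b \<Longrightarrow> (\<forall>d\<in>set w. \<bar>d\<bar> \<le> 1) \<and> run z w t \<in> rectK"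
proof (induction w arbitrary: t b)
  case Nil
  obtain x y r where b: "b = (x, y, r)" by (cases b)
  have r: "cmod (t - grid x y) \<le> of_int r / 1048576"
    using Nil(1) by (simp add: b disc_def dist_norm norm_minus_commute)
  have "\<bar>x\<bar> + r \<le> 1373529" "\<bar>y\<bar> + r \<le> 523239" using Nil(2) by (simp_all add: b inK_def)
  then have xy: "\<bar>real_of_int x\<bar> + of_int r \<le> 1373529" "\<bar>real_of_int y\<bar> + of_int r \<le> 523239"
    by linarith+
  have "\<bar>Re t - of_int x / 1048576\<bar> \<le> of_int r / 1048576" "\<bar>Im t - of_int y / 1048576\<bar> \<le> of_int r / 1048576"
    using abs_Re_le_cmod[of "t - grid x y"] abs_Im_le_cmod[of "t - grid x y"] r
    by (simp_all add: grid_def)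
  then have "\<bar>Re t\<bar> \<le> 1373529 / 1048576" "\<bar>Im t\<bar> \<le> 523239 / 1048576" using xy by linarith+
  then show ?case by (simp add: rectK_def)
next
  case (Cons d w)
  then show ?case using Cons.IH[OF disc_step_sound[OF z Cons.prems(1)], of d] by simp
qed

definition square :: "int \<Rightarrow> int \<Rightarrow> int \<Rightarrow> complex set" where
  "square x y h = {t. \<bar>1048576 * Re t - of_int x\<bar> \<le> of_int h \<and> \<bar>1048576 * Im t - of_int y\<bar> \<le> of_int h}"

lemma square_subset_disc: "square x y h \<subseteq> disc (x, y, diag h)"
proof
  fix t assume t: "t \<in> square x y h"
  then have h: "0 \<le> real_of_int h" by (auto simp: square_def)
  define u v where "u = 1048576 * Re t - of_int x" and "v = 1048576 * Im t - of_int y"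
  have uv: "u\<^sup>2 \<le> (of_int h)\<^sup>2" "v\<^sup>2 \<le> (of_int h)\<^sup>2"
    using t h by (auto simp: square_def u_def v_def abs_le_square_iff[symmetric])
  have eq: "t - grid x y = Complex (u / 1048576) (v / 1048576)"
    by (simp add: u_def v_def grid_def complex_eq_iff field_simps)
  have "real_of_int h * (1415 / 1000) \<le> of_int (diag h)"
    using floor_divide_of_int_eq[of "h * 1415" 1000, where 'a = real]
      floor_correct[of "real_of_int (h * 1415) / 1000"] by (simp add: diag_def)
  moreover have "cmod (t - grid x y) \<le> of_int h * (1415 / 1000) / 1048576"
  proof -
    have "(of_int h * (1415 / 1000))\<^sup>2 = (of_int h)\<^sup>2 * (2002225 / 1000000 :: real)"
      by (simp add: power_mult_distrib power2_eq_square)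
    then have "u\<^sup>2 + v\<^sup>2 \<le> (of_int h * (1415 / 1000))\<^sup>2"
      using uv zero_le_power2[of "real_of_int h"] by linarith
    then have "(u / 1048576)\<^sup>2 + (v / 1048576)\<^sup>2 \<le> (of_int h * (1415 / 1000) / 1048576)\<^sup>2"
      unfolding power_divide add_divide_distrib[symmetric] by (rule divide_right_mono) simp
    then show ?thesis unfolding eq using h by (subst cmod_le_iff) auto
  qed
  ultimately show "t \<in> disc (x, y, diag h)"
    by (simp add: disc_def dist_norm norm_minus_commute field_simps)
qed

lemma check_sound:
  assumes z: "near z"
  shows "check P c x y h \<Longrightarrow> t \<in> square x y h \<Longrightarrow>
    (\<exists>w. w \<noteq> [] \<and> length w \<le> 11 \<and> (\<forall>d\<in>set w. \<bar>d\<bar> \<le> 1) \<and> run z w t \<in> rectK) \<or>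
    (\<exists>x' y' h'. P x' y' h' \<and> t \<in> square x' y' h')"
proof (induction c arbitrary: x y h)
  case (Leaf w)
  then have "t \<in> disc (x, y, diag h)" using square_subset_disc by blast
  then show ?case using Leaf lands_sound[OF z] by fastforce
next
  case (Node c1 c2 c3 c4)
  define k where "k = h div 2"
  have k: "h = 2 * k" "check P c1 (x - k) (y - k) k" "check P c2 (x + k) (y - k) k"
    "check P c3 (x - k) (y + k) k" "check P c4 (x + k) (y + k) k"
    using Node.prems(1) by (simp_all add: Let_def k_def)
  have "t \<in> square (x - k) (y - k) k \<or> t \<in> square (x + k) (y - k) k \<or>
      t \<in> square (x - k) (y + k) k \<or> t \<in> square (x + k) (y + k) k"
    using Node.prems(2)
    by (cases "1048576 * Re t \<le> of_int x"; cases "1048576 * Im t \<le> of_int y")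
      (simp_all add: square_def k(1) abs_le_iff)
  then show ?case
    by (elim disjE) (rule Node.IH(1)[OF k(2)] Node.IH(2)[OF k(3)] Node.IH(3)[OF k(4)]
      Node.IH(4)[OF k(5)], assumption)+
qed auto

section \<open>Sets covered by their own images\<close>

lemma run_mem_imp_mem:
  assumes "z \<noteq> 0"
  shows "\<forall>d\<in>set w. \<bar>d\<bar> \<le> 1 \<Longrightarrow> run z w t \<in> series_set {-1, 0, 1} z \<Longrightarrow> t \<in> series_set {-1, 0, 1} z"
proof (induction w arbitrary: t)
  case (Cons d w)
  then have "(t - of_int d) / z \<in> series_set {-1, 0, 1} z" by simp
  moreover have "d \<in> {-1, 0, 1}" using Cons.prems(1) by auto
  ultimately have "of_int d + z * ((t - of_int d) / z) \<in> series_set {-1, 0, 1} z"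
    by (intro series_set_cons[OF assms])
  then show ?case using assms by simp
qed simp

text \<open>The digit set is symmetric, so only the upper half of the rectangle needs
  certificates.\<close>

lemma run_uminus: "run z (map uminus w) (- t) = - run z w t"
proof (induction w arbitrary: t)
  case (Cons d w)
  have "(- t - of_int (- d)) / z = - ((t - of_int d) / z)" by (simp add: diff_divide_distrib)
  then show ?case using Cons by simp
qed simp

text \<open>Dividing by \<open>z\<close> does not decrease the norm, so undoing one step increases
  it by at most the size of the digit.\<close>

lemma norm_run_le:
  assumes "z \<noteq> 0" "cmod z < 1"
  shows "\<forall>d\<in>set w. \<bar>d\<bar> \<le> 1 \<Longrightarrow> cmod t \<le> real (length w) + cmod (run z w t)"
proof (induction w arbitrary: t)
  case (Cons d w)
  let ?s = "(t - of_int d) / z"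
  have "cmod t \<le> cmod (t - of_int d) + cmod (of_int d)" using norm_triangle_sub
    by (metis add.commute)
  also have "cmod (t - of_int d) \<le> cmod ?s"
    using assms mult_right_mono[of "cmod z" 1 "cmod (t - of_int d)"]
    by (simp add: norm_divide pos_le_divide_eq mult.commute)
  also have "cmod ?s \<le> real (length w) + cmod (run z w ?s)" using Cons by simp
  also have "cmod (of_int d) \<le> 1" using Cons.prems by (simp flip: of_int_abs)
  finally show ?case by simp
qed simp

text \<open>Coinduction consumes one digit at a time, so \<open>K\<close> is enlarged to the set
  \<open>L\<close> of points on their way into \<open>K\<close>; the length bound \<open>N\<close>
  keeps \<open>L\<close> bounded.\<close>

lemma series_set_superset_of_covered:
  assumes z: "z \<noteq> 0" "cmod z < 1" and K: "bounded K"
    and cover: "\<And>t. t \<in> K \<Longrightarrow>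
      \<exists>w. w \<noteq> [] \<and> length w \<le> N \<and> (\<forall>d\<in>set w. \<bar>d\<bar> \<le> 1) \<and> run z w t \<in> K"
  shows "K \<subseteq> series_set {-1, 0, 1} z"
proof -
  define L where "L = {t. \<exists>w. length w \<le> N \<and> (\<forall>d\<in>set w. \<bar>d\<bar> \<le> 1) \<and> run z w t \<in> K}"
  have "L \<subseteq> series_set {-1, 0, 1} z"
  proof (rule series_set_coinduct[OF z])
    obtain B where B: "\<And>y. y \<in> K \<Longrightarrow> norm y \<le> B" using K bounded_iff by blast
    show "bounded L"
      unfolding bounded_iff
    proof (intro exI ballI)
      fix t assume "t \<in> L"
      then obtain w where "length w \<le> N" "\<forall>d\<in>set w. \<bar>d\<bar> \<le> 1" "run z w t \<in> K" by (auto simp: L_def)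
      then show "norm t \<le> real N + B" using norm_run_le[OF z, of w t] B[of "run z w t"] by linarith
    qed
    fix t assume "t \<in> L"
    then obtain v where v: "length v \<le> N" "\<forall>e\<in>set v. \<bar>e\<bar> \<le> 1" "run z v t \<in> K"
      by (auto simp: L_def)
    \<comment> \<open>An exhausted word means that the point is in \<open>K\<close>, where the
      covering supplies a fresh nonempty word.\<close>
    have "\<exists>w. w \<noteq> [] \<and> length w \<le> N \<and> (\<forall>e\<in>set w. \<bar>e\<bar> \<le> 1) \<and> run z w t \<in> K"
    proof (cases "v = []")
      case True
      then show ?thesis using cover v(3) by simp
    qed (use v in blast)
    then obtain d w where "length (d # w) \<le> N" "\<forall>e\<in>set (d # w). \<bar>e\<bar> \<le> 1" "run z (d # w) t \<in> K"
      by (auto simp: neq_Nil_conv)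
    then have "d \<in> {-1, 0, 1}" "(t - of_int d) / z \<in> L"
      by (auto simp: L_def intro!: exI[of _ w])
    then show "\<exists>d\<in>{-1, 0, 1}. (t - of_int d) / z \<in> L" by blast
  qed
  moreover have "K \<subseteq> L" unfolding L_def by (auto intro!: exI[of _ "[]"])
  ultimately show ?thesis by blast
qed

subsection \<open>Certificates\<close>

text \<open>Sufficient for the square to miss the upper half of \<open>rectK\<close>.\<close>

definition skipK :: "int \<Rightarrow> int \<Rightarrow> int \<Rightarrow> bool" where
  "skipK x y h \<longleftrightarrow> y + h < 0 \<or> 523239 < y - h \<or> 1373529 < x - h \<or> x + h < -1373529"

text \<open>Squares disjoint from the annulus with radii 355991 and 357040 about \<open>797944 + 714253 \<i>\<close>.
  This circle encloses the fixed point \<open>2\<^sup>2\<^sup>0 / (1 - \<omega>)\<close> and was found by a computer search,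
  because circles centred at the fixed point run into holes of the difference set.\<close>

definition skipA :: "int \<Rightarrow> int \<Rightarrow> int \<Rightarrow> bool" where
  "skipA x y h \<longleftrightarrow> (let s = diag h; q = (x - 797944)\<^sup>2 + (y - 714253)\<^sup>2 in
     s < 355991 \<and> q < (355991 - s)\<^sup>2 \<or> (357040 + s)\<^sup>2 < q)"

text \<open>Its root square has half-side 1 and centre -1; the one for \<open>certK2\<close> has
  centre 1. Together they contain \<open>rectK\<close>.\<close>

definition certK1 :: "int list list" where
  "certK1 =
     [[2], [2], [], [], [], [2], [], [], [2], [], [], [], [-1], [-1], [2], [], [], [2], [], [],
     [2], [], [], [-1], [-1], [2], [], [], [0,-1,1], [2], [], [], [0,-1,1], [2], [], [], [0,-1,1],
     [0,-1,1,0,0,-1], [2], [], [], [2], [], [], [2], [], [], [2], [], [], [0,-1,1,0,0], [0,-1],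
     [0,-1], [0], [0], [2], [], [2], [2], [], [2], [], [-1], [], [-1,0,0], [], [2], [], [2], [2],
     [-1,0,0], [-1,0,0], [-1,0,1,0,1,1,0,-1], [-1,0,0], [-1,0,0], [2], [2], [-1,0,1,0,1,1,0,-1],
     [-1,0,0], [-1,0,1,0,1,1,0], [-1,0,1,0,1], [-1,0,0], [2], [-1,0,1,0,1,1,0], [-1,0,1,0,1],
     [-1,0,1,0,1,1], [-1,0,0,1,0], [-1,0,0], [-1,0,0], [], [2], [-1,0,0,1,0,-1], [-1,0,1,0,1],
     [2], [-1,0,0,1,0,-1], [-1,0,1,0,1], [-1,0,0,1,0,-1], [-1,0,1,0,1], [-1,0], [2], [-1], [-1],
     [2], [-1], [-1], [-1,0], [-1], [-1], [2], [], [2], [], [2], [2], [-1,0,1,0,1,0,0,-1], [-1,0],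
     [-1,0,1,0], [-1,0], [-1,0], [-1,0,1,0], [-1,0], [], [-1,0], [], [-1,0,1], [2], [-1,0],
     [-1,0], [-1,0,1], [-1,0], [], [], [2], [2], [-1], [2], [-1], [2], [-1,1], [2], [-1,1],
     [-1,1,-1,0,0], [-1,1], [-1,1], [-1,1], [-1,1], [-1], [-1,1], [-1], [-1], [2], [2], [2], [2],
     [-1,1,-1,0,0,1], [-1,1,-1], [-1,1], [-1,1], [-1,1,-1], [-1,1], [-1,1], [-1,1,-1], [-1,1],
     [2], [-1,1], [-1,1,-1], [-1,1,-1,0], [2], [-1,1,-1,-1,0,-1], [0,0,1,0,1], [2],
     [0,0,0,1,0,-1], [0,0,1,0,1], [0,0,0,1,0,-1], [0,0,1,0,1], [0,0], [2], [0], [0], [2], [0],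
     [0], [0,0], [0], [0], [2], [-1,1], [2], [2], [-1,1], [2], [-1,1], [-1,1,-1,0,-1,0,0,1],
     [-1,1,-1,0,-1], [-1,1,-1,0,-1,0,0,1], [-1,1,-1,0,-1], [-1,1,0,-1,0,1], [2], [2],
     [0,0,1,0,1,0,0,-1], [0,0], [0,0,1,0], [0,0], [0,0], [0,0,1,0], [0,0], [2], [-1,1,0],
     [-1,1,-1,0,-1,-1], [-1,1,0], [0,0,1], [0,0], [-1], [0,0,1], [2], [0,0], [0,0], [0,0,1],
     [0,0], [], []]"

definition certK2 :: "int list list" where
  "certK2 =
     [[2], [2], [], [], [2], [], [], [2], [], [], [0], [0], [2], [], [], [1,-1,1], [2], [], [],
     [1,-1,1], [2], [], [], [1,-1,1], [1,-1,1,0,0,-1], [2], [], [], [2], [], [], [2], [], [], [2],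
     [], [], [1,-1,1,0,0], [1,-1], [1,-1], [1], [1], [2], [], [], [2], [], [], [2], [], [], [1],
     [1], [2], [], [], [2], [], [], [1], [], [], [], [2], [2], [0], [2], [0], [2], [0,1], [2],
     [0,1], [0,1,-1,0,0], [0,1], [0,1], [0,1], [0,1], [0], [0,1], [0], [0], [2], [2], [2], [2],
     [0,1,-1,0,0,1], [0,1,-1], [0,1], [0,1], [0,1,-1], [0,1], [0,1], [0,1,-1], [0,1], [2], [0,1],
     [0,1,-1], [0,1,-1,0], [2], [0,1,-1,-1,0,-1], [1,0,1,0,1], [2], [1,0,0,1,0,-1], [1,0,1,0,1],
     [1,0,0,1,0,-1], [1,0,1,0,1], [1,0], [2], [1], [1], [2], [1], [1], [1,0], [1], [1], [2],
     [0,1], [2], [2], [0,1], [2], [0,1], [0,1,-1,0,-1,0,0,1], [0,1,-1,0,-1], [0,1,-1,0,-1,0,0,1],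
     [0,1,-1,0,-1], [0,1,0,-1,0,1], [2], [2], [1,0,1,0,1,0,0,-1], [1,0], [1,0,1,0], [1,0], [1,0],
     [1,0,1,0], [1,0], [2], [0,1,0], [0,1,-1,0,-1,-1], [0,1,0], [1,0,1], [1,0], [0], [1,0,1], [2],
     [1,0], [1,0], [1,0,1], [1,0], [], [], [2], [2], [1], [2], [1], [], [1], [], [1], [1], [], [],
     []]"

text \<open>Its root square has half-side 1/2 and the centre of the annulus; its words carry the
  annulus into \<open>rectK\<close>.\<close>

definition certA :: "int list list" where
  "certA =
     [[2], [2], [], [2], [], [], [2], [], [2], [], [], [], [0,1,0], [0], [0], [2], [2], [], [],
     [0,1,0], [1,0,1], [1,0], [1,0,1], [], [0,1], [2], [0], [], [], [], [2], [1,0], [], [2], [],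
     [2], [], [1,0], [], [], [], [], [2], [1], [], [2], [2], [], [], [], [], [1], [], [1,1,0], [],
     [2], [2], [], [2], [0,1], [], [0,1], [0,1,1], [], [0,1,1], [2], [], [], [2], [], [], [0,1,1],
     [], [], [], [2], [2], [2], [2], [], [0,1,1], [], [], [0,1,1,-1], [], [2], [], [0,1,1,-1], [],
     [], [0,1,1,-1], [], [2], [], [0,1,1,-1,-1], [], [], [2], [2], [], [], [], [], [], [2],
     [0,1,1,-1,-1,-1], [2], [0,1,1,-1,-1,-1], [], [0,1,1,-1,-1,-1], [0,1,1,-1,-1,-1], [], [], [2],
     [2], [], [], [0,1,1,-1,-1,-1,1], [2], [0,1,1,-1,-1,-1,1], [], [0,1,1,-1,-1,-1,1], [2],
     [0,1,1,-1,-1,-1,1], [0,1,1,-1,-1,-1,1,1,0,0,-1], [], [], [2], [], [], [2], [], [], [2], [2],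
     [2], [], [], [], [], [], [0,1,1,-1,-1,-1,1,1,0,0,-1], [1,1,1,1,1,-1,-1,-1,0,1,1],
     [1,1,1,1,1,-1,-1,-1,0,1], [2], [], [], [], [], [1,1,1,1,1,-1,-1,-1,0,1], [2],
     [1,1,1,1,1,-1,-1,-1,0,1], [1,1,1,1,1,-1,-1], [1,1,1,1,1,-1,-1,-1,0,1],
     [1,1,1,1,1,-1,-1,-1,0,1], [1,1,1,1,1,-1,-1], [2], [], [], [], [], [2], [], [], [], [], [],
     [], [2], [2], [], [], [], [2], [], [], [], [1,1,1], [2], [2], [], [1,1,1,0,1], [2], [], [],
     [], [], [1,1,1,0,1], [], [2], [2], [], [1,1,1,0], [], [1,1,1], [1,1], [1,1,1], [], [], [2],
     [2], [], [1,1,1,1,1], [2], [2], [], [], [1,1,1,1,1,-1,-1], [1,1,1,1,1,-1], [1,1,1,1,1,-1],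
     [2], [], [], [], [], [2], [], [], [], [], [2], [1,1,1,1,1,-1], [2], [1,1,1,1,1], [1,1,1,1,1],
     [2], [], [], [], [], [], [], [], [2], [1,1,1,1], [1,1,1], [2], [2], [1,1,1,1,1], [], [], [],
     [], [], [], [], [], [], []]"

text \<open>A disc in the complement of the difference set whose centre is at distance about 0.0876 from
  \<open>1/(1 - \<omega>)\<close>, found by a computer search.\<close>

lemma escapes_hole: "escapes 20 (990420, 727926, 524)" by code_simp

text \<open>The disc contains \<open>-1 / z\<close> for all \<open>z\<close> near \<omega>.\<close>

lemma forced_prefix: "forced [-1, 1, 1, 1, -1, -1, -1] (-955536, 1334688, 54)" by code_simp

text \<open>A disc about \<open>1 / (1 - \<omega>)\<close> large enough to contain the hole of
  \<open>escapes_hole\<close>. Its radius is a permitted deviation of 99574 units plus the 40 units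
  of \<open>near_fixed_point\<close>.\<close>

lemma forced_one: "forced [1] (991427, 819813, 99614)" by code_simp

lemma check_A: "check skipA (cert_of certA) 797944 714253 524288" by code_simp

lemma check_K1: "check skipK (cert_of certK1) (-1048576) 0 1048576" by code_simp

lemma check_K2: "check skipK (cert_of certK2) 1048576 0 1048576" by code_simp

lemma rectK_subset:
  assumes z: "near z"
  shows "rectK \<subseteq> series_set {-1, 0, 1} z"
proof (rule series_set_superset_of_covered[where N = 11])
  show "z \<noteq> 0" "cmod z < 1" using near_norm[OF z] by blast+
  have "rectK \<subseteq> cbox (Complex (-2) (-2)) (Complex 2 2)"
    by (auto simp: rectK_def in_cbox_complex_iff)
  then show "bounded rectK" using bounded_cbox bounded_subset by blast
  have upper: "\<exists>w. w \<noteq> [] \<and> length w \<le> 11 \<and> (\<forall>d\<in>set w. \<bar>d\<bar> \<le> 1) \<and> run z w t \<in> rectK"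
    if t: "t \<in> rectK" "0 \<le> Im t" for t
  proof -
    have "t \<in> square (-1048576) 0 1048576 \<or> t \<in> square 1048576 0 1048576"
      using t by (auto simp: rectK_def square_def abs_le_iff)
    moreover have "\<not> (skipK x y h \<and> t \<in> square x y h)" for x y h
    proof
      assume a: "skipK x y h \<and> t \<in> square x y h"
      then have "real_of_int y + of_int h < 0 \<or> 523239 < real_of_int y - of_int h \<or>
          1373529 < real_of_int x - of_int h \<or> real_of_int x + of_int h < -1373529"
        unfolding skipK_def by linarith
      then show False using a t by (auto simp: rectK_def square_def abs_le_iff)
    qed
    ultimately show ?thesis
      using check_sound[OF z check_K1] check_sound[OF z check_K2] by blast
  qed
  fix t assume t: "t \<in> rectK"
  show "\<exists>w. w \<noteq> [] \<and> length w \<le> 11 \<and> (\<forall>d\<in>set w. \<bar>d\<bar> \<le> 1) \<and> run z w t \<in> rectK"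
  proof (cases "0 \<le> Im t")
    case True
    then show ?thesis by (rule upper[OF t])
  next
    case False
    then have "- t \<in> rectK" "0 \<le> Im (- t)" using t by (auto simp: rectK_def)
    then obtain w where "w \<noteq> []" "length w \<le> 11" "\<forall>d\<in>set w. \<bar>d\<bar> \<le> 1" "run z w (- t) \<in> rectK"
      using upper by blast
    then show ?thesis using run_uminus[of z w "- t"]
      by (intro exI[of _ "map uminus w"]) (auto simp: rectK_def)
  qed
qed

text \<open>The certificate carries each point of the annulus into \<open>rectK\<close>, which lies
  in the difference set; prepending the digits of the word leads back.\<close>

lemma annulus_subset:
  assumes z: "near z"
    and t: "355991 / 1048576 \<le> cmod (t - grid 797944 714253)" "cmod (t - grid 797944 714253) \<le> 357040 / 1048576"
  shows "t \<in> series_set {-1, 0, 1} z"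
proof -
  let ?q = "grid 797944 714253"
  have "\<bar>Re t - 797944 / 1048576\<bar> \<le> 357040 / 1048576" "\<bar>Im t - 714253 / 1048576\<bar> \<le> 357040 / 1048576"
    using abs_Re_le_cmod[of "t - ?q"] abs_Im_le_cmod[of "t - ?q"] t(2) by (simp_all add: grid_def)
  then have "\<bar>1048576 * Re t - 797944\<bar> \<le> 524288" "\<bar>1048576 * Im t - 714253\<bar> \<le> 524288"
    by linarith+
  then have "t \<in> square 797944 714253 524288" by (simp add: square_def)
  moreover have "\<not> (skipA x y h \<and> t \<in> square x y h)" for x y h
  proof
    assume a: "skipA x y h \<and> t \<in> square x y h"
    define s where "s = diag h"
    let ?c = "cmod (grid x y - ?q)"
    have "t \<in> disc (x, y, s)" using a square_subset_disc by (auto simp: s_def)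
    then have ts: "cmod (grid x y - t) \<le> of_int s / 1048576" by (simp add: disc_def dist_norm)
    have s0: "0 \<le> real_of_int s" using norm_ge_zero order_trans[OF _ ts] by fastforce
    define q where "q = (x - 797944)\<^sup>2 + (y - 714253)\<^sup>2"
    have c: "(1048576 * ?c)\<^sup>2 = of_int q"
      unfolding power_mult_distrib cmod_power2 q_def
      by (simp add: grid_def power2_eq_square field_simps)
    have tri: "cmod (t - ?q) \<le> ?c + cmod (grid x y - t)" "?c \<le> cmod (t - ?q) + cmod (grid x y - t)"
      using norm_triangle_ineq4[of "grid x y - ?q" "grid x y - t"]
        norm_triangle_ineq[of "t - ?q" "grid x y - t"] by (simp_all add: algebra_simps)
    have "s < 355991 \<and> q < (355991 - s)\<^sup>2 \<or> (357040 + s)\<^sup>2 < q"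
      using a by (simp add: skipA_def Let_def s_def q_def)
    then show False
    proof
      assume 1: "s < 355991 \<and> q < (355991 - s)\<^sup>2"
      then have "(1048576 * ?c)\<^sup>2 < of_int ((355991 - s)\<^sup>2)" unfolding c of_int_less_iff by blast
      then have "1048576 * ?c < 355991 - of_int s"
        using 1 by (intro power2_less_imp_less[where y = "355991 - real_of_int s"]) auto
      then show False using tri(1) ts t(1) by linarith
    next
      assume "(357040 + s)\<^sup>2 < q"
      then have "of_int ((357040 + s)\<^sup>2) < (1048576 * ?c)\<^sup>2" unfolding c of_int_less_iff .
      then have "357040 + of_int s < 1048576 * ?c"
        by (intro power2_less_imp_less[where y = "1048576 * ?c"]) auto
      then show False using tri(2) ts t(2) by linarith
    qed
  qed
  ultimately obtain w where "\<forall>d\<in>set w. \<bar>d\<bar> \<le> 1" "run z w t \<in> rectK"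
    using check_sound[OF z check_A] by blast
  then show ?thesis
    using run_mem_imp_mem[OF near_norm(3)[OF z]] rectK_subset[OF z] by blast
qed

subsection \<open>Rescaling near the root\<close>

text \<open>The polynomial \<open>(1 + X) ^ k - 1\<close> has nonnegative coefficients. Serves to
  compare \<open>(\<omega> + h) ^ k\<close> with \<open>\<omega> ^ k\<close>.\<close>

lemma norm_one_plus_power_diff_le:
  fixes e :: complex
  shows "cmod ((1 + e) ^ k - 1) \<le> (1 + cmod e) ^ k - 1"
proof (induction k)
  case (Suc k)
  have eq: "(1 + e) ^ Suc k - 1 = (1 + e) * ((1 + e) ^ k - 1) + e" by (simp add: algebra_simps)
  have "cmod ((1 + e) * ((1 + e) ^ k - 1)) \<le> (1 + cmod e) * ((1 + cmod e) ^ k - 1)"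
    unfolding norm_mult using Suc norm_triangle_ineq[of 1 e] by (intro mult_mono) auto
  then have "cmod ((1 + e) ^ Suc k - 1) \<le> (1 + cmod e) * ((1 + cmod e) ^ k - 1) + cmod e"
    unfolding eq by (rule norm_triangle_mono) simp
  then show ?case by (simp add: algebra_simps)
qed simp

text \<open>For \<open>h = \<omega> ^ k * u / D\<close>, the value \<open>v (\<omega> + h)\<close>
  is about \<open>D * h = \<omega> ^ k * u\<close>. Dividing by \<open>(\<omega> + h) ^ k\<close>
  instead of \<open>\<omega> ^ k\<close> is harmless since \<open>k * \<omega> ^ k\<close> tends to
  0.\<close>

lemma rescaled_limit:
  fixes v :: "complex \<Rightarrow> complex"
  assumes v: "(v has_field_derivative D) (at \<omega>)" "v \<omega> = 0" "D \<noteq> 0"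
    and w: "\<omega> \<noteq> 0" "cmod \<omega> < 1" and e: "0 < e" "0 < e'"
  shows "\<exists>N. \<forall>k\<ge>N. \<forall>u. cmod u \<le> 1 \<longrightarrow> cmod (\<omega> ^ k * u / D) < e' \<and>
    cmod (v (\<omega> + \<omega> ^ k * u / D) / (\<omega> + \<omega> ^ k * u / D) ^ k - u) < e"
proof -
  \<comment> \<open>The final error is at most \<open>4 * \<eta>\<close>, hence at most
    \<open>e / 2\<close>.\<close>
  define \<eta> where "\<eta> = min (1 / 2) (e / 8)"
  have \<eta>: "0 < \<eta>" "\<eta> \<le> 1 / 2" "\<eta> \<le> e / 8" using e by (auto simp: \<eta>_def)
  have "(\<lambda>h. v (\<omega> + h) / h) \<midarrow>0\<rightarrow> D" using v(1,2) by (simp add: DERIV_def)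
  then have "(\<lambda>h. v (\<omega> + h) / h / D) \<midarrow>0\<rightarrow> D / D" using v(3) by (intro tendsto_divide tendsto_const)
  then obtain \<delta> where \<delta>: "0 < \<delta>" "\<And>h. h \<noteq> 0 \<Longrightarrow> cmod h < \<delta> \<Longrightarrow> cmod (v (\<omega> + h) / h / D - 1) < \<eta>"
    using \<eta>(1) v(3) by (auto simp: LIM_def dist_norm)
  have "(\<lambda>k. cmod \<omega> ^ k / cmod D) \<longlonglongrightarrow> 0 / cmod D"
    using w v(3) by (intro tendsto_divide tendsto_const LIMSEQ_power_zero) auto
  then have "\<forall>\<^sub>F k in sequentially. cmod \<omega> ^ k / cmod D < min \<delta> e'"
    using \<delta>(1) e by (intro order_tendstoD(2)[where y = 0]) auto
  moreover have "\<forall>\<^sub>F k in sequentially. (1 + cmod \<omega> ^ k / (cmod D * cmod \<omega>)) ^ k - 1 < \<eta>"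
  proof -
    have "(\<lambda>k. of_nat k * cmod \<omega> ^ k) \<longlonglongrightarrow> 0" using w by (intro powser_times_n_limit_0) auto
    then have "(\<lambda>k. exp (of_nat k * cmod \<omega> ^ k / (cmod D * cmod \<omega>)) - 1) \<longlonglongrightarrow> exp (0 / (cmod D * cmod \<omega>)) - 1"
      using w v(3) by (intro tendsto_intros) auto
    then have "\<forall>\<^sub>F k in sequentially. exp (of_nat k * cmod \<omega> ^ k / (cmod D * cmod \<omega>)) - 1 < \<eta>"
      using \<eta>(1) by (intro order_tendstoD(2)[where y = 0]) auto
    then show ?thesis
    proof eventually_elim
      case (elim k)
      let ?q = "cmod \<omega> ^ k / (cmod D * cmod \<omega>)"
      have "(1 + ?q) ^ k \<le> exp ?q ^ k" by (intro power_mono exp_ge_add_one_self) auto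
      also have "\<dots> = exp (of_nat k * ?q)" by (rule exp_of_nat_mult[symmetric])
      finally show ?case using elim by simp
    qed
  qed
  ultimately have "\<forall>\<^sub>F k in sequentially. \<forall>u. cmod u \<le> 1 \<longrightarrow> cmod (\<omega> ^ k * u / D) < e' \<and>
    cmod (v (\<omega> + \<omega> ^ k * u / D) / (\<omega> + \<omega> ^ k * u / D) ^ k - u) < e"
  proof (eventually_elim, intro allI impI)
    fix k u
    assume k: "cmod \<omega> ^ k / cmod D < min \<delta> e'" "(1 + cmod \<omega> ^ k / (cmod D * cmod \<omega>)) ^ k - 1 < \<eta>"
      and u: "cmod u \<le> 1"
    define h where "h = \<omega> ^ k * u / D"
    have "cmod h = cmod \<omega> ^ k / cmod D * cmod u"
      by (simp add: h_def norm_mult norm_divide norm_power)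
    also have "\<dots> \<le> cmod \<omega> ^ k / cmod D" using u by (intro mult_left_le) auto
    finally have h: "cmod h \<le> cmod \<omega> ^ k / cmod D" .
    have "cmod (v (\<omega> + h) / (\<omega> + h) ^ k - u) < e"
    proof (cases "h = 0")
      case True
      then have "u = 0" using w v(3) by (simp add: h_def)
      then show ?thesis using True v(2) e by simp
    next
      case False
      define A X where "A = v (\<omega> + h) / h / D" and "X = (1 + h / \<omega>) ^ k"
      have A: "cmod (A - 1) < \<eta>" unfolding A_def using False h k(1) by (intro \<delta>(2)) auto
      have "cmod (h / \<omega>) \<le> cmod \<omega> ^ k / (cmod D * cmod \<omega>)"
        using h w(1) by (simp add: norm_divide field_simps)
      then have "(1 + cmod (h / \<omega>)) ^ k \<le> (1 + cmod \<omega> ^ k / (cmod D * cmod \<omega>)) ^ k"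
        by (intro power_mono) auto
      then have X: "cmod (X - 1) < \<eta>"
        using norm_one_plus_power_diff_le[of "h / \<omega>" k] k(2) by (simp add: X_def)
      have X2: "1 / 2 \<le> cmod X" using norm_triangle_ineq2[of 1 "1 - X"] X \<eta>(2)
        by (simp add: norm_minus_commute)
      then have X0: "X \<noteq> 0" by auto
      have "(\<omega> + h) ^ k = \<omega> ^ k * X"
      proof -
        have "\<omega> + h = \<omega> * (1 + h / \<omega>)" using w(1) by (simp add: field_simps)
        then show ?thesis by (simp only: X_def power_mult_distrib)
      qed
      moreover have "v (\<omega> + h) = A * (\<omega> ^ k * u)"
        using False v(3) by (simp add: A_def h_def)
      ultimately have "v (\<omega> + h) / (\<omega> + h) ^ k = A * u / X"
        using w(1) X0 by simp
      then have eq: "v (\<omega> + h) / (\<omega> + h) ^ k - u = u * ((A - 1) - (X - 1)) / X"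
        using X0 by (simp add: field_simps)
      have "cmod (u * ((A - 1) - (X - 1))) \<le> 1 * (2 * \<eta>)"
        unfolding norm_mult using u A X norm_triangle_ineq4[of "A - 1" "X - 1"]
        by (intro mult_mono) auto
      then have "cmod (u * ((A - 1) - (X - 1)) / X) \<le> (1 * (2 * \<eta>)) / (1 / 2)"
        unfolding norm_divide using X2 \<eta> by (intro frac_le) auto
      then show ?thesis unfolding eq using \<eta> e by simp
    qed
    then show "cmod (\<omega> ^ k * u / D) < e' \<and>
        cmod (v (\<omega> + \<omega> ^ k * u / D) / (\<omega> + \<omega> ^ k * u / D) ^ k - u) < e"
      using h k(1) by (simp add: h_def)
  qed
  then show ?thesis by (simp add: eventually_sequentially)
qed

section \<open>Tails of the expansions of \<open>-1 / z\<close>\<close>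

definition root_poly :: "complex \<Rightarrow> complex" where
  "root_poly z = 1 - 2*z + 2*z^2 - 2*z^5 + 2*z^8"

text \<open>After the forced digits the remaining tail is \<open>1 / (1 - z) - offset z\<close>; every further digit
  1 divides the deviation from the fixed point \<open>1 / (1 - z)\<close> by \<open>z\<close>.\<close>

definition offset :: "complex \<Rightarrow> complex" where
  "offset z = root_poly z / ((1 - z) * z ^ 8)"

abbreviation diffset :: "complex \<Rightarrow> complex set" where
  "diffset \<equiv> series_set {-1, 0, 1}"

text \<open>Shows where the polynomial comes from: it vanishes exactly when the tail after the seven
  digits is the geometric series \<open>1 / (1 - z)\<close>.\<close>

lemma run_prefix:
  assumes "z \<noteq> 0" "z \<noteq> 1"
  shows "run z [-1, 1, 1, 1, -1, -1, -1] (-1 / z) = 1 / (1 - z) - offset z"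
proof -
  have z1: "1 - z \<noteq> 0" using assms by simp
  define X where "X = 1 / (1 - z) - offset z"
  have "X = (z ^ 8 - root_poly z) / (z ^ 8 * (1 - z))"
    using assms(1) by (simp add: X_def offset_def diff_divide_distrib mult.commute)
  then have "X * (z ^ 8 * (1 - z)) = z ^ 8 - root_poly z"
    using assms(1) z1
      by (simp only: divide_eq_eq nonzero_eq_divide_eq mult_eq_0_iff power_eq_0_iff) simp
  moreover have "z ^ 8 - root_poly z = (1 - z) * - (1 - z + z^2 + z^3 + z^4 - z^5 - z^6 - z^7)"
    unfolding root_poly_def by algebra
  moreover have "X * (z ^ 8 * (1 - z)) = (1 - z) * (z ^ 8 * X)" by (simp only: mult_ac)
  ultimately have "(1 - z) * (z ^ 8 * X) = (1 - z) * - (1 - z + z^2 + z^3 + z^4 - z^5 - z^6 - z^7)"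
    by (simp only:)
  then have X: "z ^ 8 * X = - (1 - z + z^2 + z^3 + z^4 - z^5 - z^6 - z^7)"
    using z1 by simp
  have "z ^ 8 * run z [-1, 1, 1, 1, -1, -1, -1] (-1 / z) = - (1 - z + z^2 + z^3 + z^4 - z^5 - z^6 - z^7)"
    using assms(1) by (simp add: field_simps power_numeral_even power_numeral_odd)
  then have "z ^ 8 * run z [-1, 1, 1, 1, -1, -1, -1] (-1 / z) = z ^ 8 * X" by (simp only: X)
  moreover have "z ^ 8 \<noteq> 0" using assms(1) by simp
  ultimately show ?thesis unfolding X_def by (rule mult_left_cancel[THEN iffD1, rotated])
qed

text \<open>Prepending the digit 1 fixes \<open>1 / (1 - z)\<close> and multiplies the deviation by
  \<open>z\<close>; after \<open>k\<close> such digits the seven prefix digits lead back to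
  \<open>-1 / z\<close>.\<close>

lemma mem_diffset_imp_Mset:
  assumes z: "near z" and mem: "1 / (1 - z) - offset z / z ^ k \<in> diffset z"
  shows "z \<in> Mset"
proof -
  note nz = near_norm[OF z]
  have z1: "z \<noteq> 1" using nz(4) by auto
  have "1 / (1 - z) - offset z \<in> diffset z"
    using mem
  proof (induction k)
    case (Suc k)
    have "of_int 1 + z * (1 / (1 - z) - offset z / z ^ Suc k) \<in> diffset z"
      using Suc.prems nz(3) by (intro series_set_cons) auto
    also have "of_int 1 + z * (1 / (1 - z) - offset z / z ^ Suc k) = 1 / (1 - z) - offset z / z ^ k"
      using nz(3) z1 by (simp add: field_simps)
    finally show ?case by (rule Suc.IH)
  qed simp
  then have "-1 / z \<in> diffset z"
    unfolding run_prefix[OF nz(3) z1, symmetric] by (rule run_mem_imp_mem[OF nz(3), rotated]) simp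
  then show ?thesis using nz by (simp add: Mset_iff)
qed

lemma inverse_mem_disc:
  assumes "near z"
  shows "-1 / z \<in> disc (-955536, 1334688, 54)"
proof -
  have "grid (-955536) 1334688 - -1 / z = 1 / z - grid 955536 (-1334688)"
    by (simp add: grid_def complex_eq_iff)
  then show ?thesis using near_inverse(1)[OF assms] by (simp add: disc_def dist_norm)
qed

lemma fixed_point_diff_mem_disc:
  assumes z: "near z" and v: "cmod v \<le> 99574 / 1048576"
  shows "1 / (1 - z) - v \<in> disc (991427, 819813, 99614)"
proof -
  have "cmod ((1 / (1 - z) - grid 991427 819813) - v) \<le> 40 / 1048576 + 99574 / 1048576"
    using norm_triangle_ineq4[of "1 / (1 - z) - grid 991427 819813" v] near_fixed_point[OF z] v
      by linarith
  then show ?thesis by (simp add: disc_def dist_norm norm_minus_commute algebra_simps)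
qed

lemma forced_prefix_sound:
  assumes z: "near z" and c: "\<forall>i. c i \<in> {-1, 0, 1}" "(\<lambda>i. of_int (c i) * z ^ i) sums (-1 / z)"
  shows "(\<forall>i<7. c i = [-1, 1, 1, 1, -1, -1, -1] ! i) \<and>
    (\<lambda>i. of_int (c (i + 7)) * z ^ i) sums (1 / (1 - z) - offset z)"
proof -
  have len: "length [-1, 1, 1, 1, -1, -1, -1 :: int] = 7" by simp
  have z1: "z \<noteq> 1" using near_norm(4)[OF z] by auto
  show ?thesis
    using forced_sound[OF z inverse_mem_disc[OF z] forced_prefix c]
    unfolding len run_prefix[OF near_norm(3)[OF z] z1] .
qed

text \<open>As \<open>cmod z < 1\<close>, the deviations before step \<open>k\<close> are no larger
  than the one at \<open>k\<close>, so \<open>forced_one\<close> applies all along.\<close>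

lemma Mset_imp_mem_diffset:
  assumes z: "near z" and M: "z \<in> Mset" and v: "cmod (offset z / z ^ k) \<le> 99574 / 1048576"
  shows "1 / (1 - z) - offset z / z ^ k \<in> diffset z"
proof -
  note nz = near_norm[OF z]
  have z1: "z \<noteq> 1" using nz(4) by auto
  have "1 / (1 - z) - offset z / z ^ j \<in> diffset z" if "j \<le> k" for j
    using that
  proof (induction j)
    case 0
    obtain c where c: "\<forall>i. c i \<in> {-1, 0, 1}" "(\<lambda>i. of_int (c i) * z ^ i) sums (-1 / z)"
      using M by (auto simp: Mset_iff series_set_def)
    have "(\<lambda>i. of_int (c (i + 7)) * z ^ i) sums (1 / (1 - z) - offset z)"
      using forced_prefix_sound[OF z c] by blast
    then show ?case using c(1)
      unfolding series_set_def by (intro CollectI exI[of _ "\<lambda>i. c (i + 7)"]) simp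
  next
    case (Suc j)
    let ?t = "1 / (1 - z) - offset z / z ^ j"
    obtain c where c: "\<forall>i. c i \<in> {-1, 0, 1}" "(\<lambda>i. of_int (c i) * z ^ i) sums ?t"
      using Suc by (auto simp: series_set_def)
    have "offset z / z ^ j = offset z / z ^ k * z ^ (k - j)"
      using nz(3) Suc.prems by (simp add: power_diff)
    then have "cmod (offset z / z ^ j) = cmod (offset z / z ^ k) * cmod z ^ (k - j)"
      by (simp only: norm_mult norm_power)
    also have "\<dots> \<le> cmod (offset z / z ^ k)"
      using nz by (intro mult_left_le power_le_one) auto
    finally have "?t \<in> disc (991427, 819813, 99614)"
      using v by (intro fixed_point_diff_mem_disc[OF z]) linarith
    then have "(\<lambda>i. of_int (c (i + 1)) * z ^ i) sums ((?t - 1) / z)"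
      using forced_sound[OF z _ forced_one c] by simp
    moreover have "(?t - 1) / z = 1 / (1 - z) - offset z / z ^ Suc j"
      using nz(3) z1 by (simp add: field_simps)
    ultimately show ?case using c(1)
      unfolding series_set_def by (intro CollectI exI[of _ "\<lambda>i. c (i + 1)"]) simp
  qed
  then show ?thesis by blast
qed

text \<open>With zero offset the tail stays at \<open>1 / (1 - z)\<close>, so
  \<open>forced_one\<close> applies at every later digit.\<close>

lemma digits_nonzero:
  assumes z: "near z" "offset z = 0"
    and c: "\<forall>i. c i \<in> {-1, 0, 1}" "(\<lambda>i. of_int (c i) * z ^ i) sums (-1 / z)"
  shows "c i \<in> {-1, 1}"
proof -
  note nz = near_norm[OF z(1)]
  have z1: "z \<noteq> 1" using nz(4) by auto
  let ?w = "[-1, 1, 1, 1, -1, -1, -1] :: int list"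
  have pre: "\<forall>i<7. c i = ?w ! i" and "(\<lambda>i. of_int (c (i + 7)) * z ^ i) sums (1 / (1 - z))"
    using forced_prefix_sound[OF z(1) c] z(2) by simp_all
  then have tail: "(\<lambda>i. of_int (c (i + (7 + n))) * z ^ i) sums (1 / (1 - z)) \<and> c (7 + n) = 1" for n
  proof (induction n)
    have step: "c m = 1 \<and> (\<lambda>i. of_int (c (i + Suc m)) * z ^ i) sums (1 / (1 - z))"
      if "(\<lambda>i. of_int (c (i + m)) * z ^ i) sums (1 / (1 - z))" for m
    proof -
      have d: "\<forall>i. c (i + m) \<in> {-1, 0, 1}" using c(1) by blast
      have p: "1 / (1 - z) \<in> disc (991427, 819813, 99614)"
        using fixed_point_diff_mem_disc[OF z(1), of 0] by simp
      have "(1 / (1 - z) - 1) / z = 1 / (1 - z)" using nz(3) z1 by (simp add: field_simps)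
      then show ?thesis
        using forced_sound[OF z(1) p forced_one d that] by simp
    qed
    {
      case 0
      then show ?case using step[of 7] by simp
    next
      case (Suc n)
      then show ?case using step[of "7 + n"] step[of "Suc (7 + n)"] by simp
    }
  qed
  show ?thesis
  proof (cases "i < 7")
    case True
    then have "c i \<in> set ?w" using pre nth_mem[of i ?w] by simp
    then show ?thesis by auto
  next
    case False
    then show ?thesis using tail[of "i - 7"] by simp
  qed
qed

text \<open>For digits 0 and 1, a difference of 1 or -1 forces the sum 1. Adding the two expansions
  therefore gives the geometric series, which determines the common point.\<close>

lemma ifs_images_meet_half:
  assumes z: "near z" "offset z = 0"
  shows "ifs_f z ` Lambda z \<inter> ifs_g z ` Lambda z = {1/2}"
proof -
  note nz = near_norm[OF z(1)]
  have z1: "1 - z \<noteq> 0" using nz(4) by auto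
  have geo: "(\<lambda>i. z ^ i) sums (1 / (1 - z))" using nz(4) by (rule geometric_sums)
  have "1 / (1 - z) \<in> diffset z"
    unfolding series_set_def using geo by (intro CollectI exI[of _ "\<lambda>_. 1"]) simp
  then have "z \<in> Mset" using z by (intro mem_diffset_imp_Mset[of z 0]) simp_all
  then have ne: "ifs_f z ` Lambda z \<inter> ifs_g z ` Lambda z \<noteq> {}"
    using ifs_images_meet_iff[OF nz(3,4)] by (simp add: Mset_iff)
  have "x = 1/2" if x: "x \<in> ifs_f z ` Lambda z \<inter> ifs_g z ` Lambda z" for x
  proof -
    obtain a b :: "nat \<Rightarrow> int" and s where
      ab: "\<forall>i. a i \<in> {0, 1}" "\<forall>i. b i \<in> {0, 1}"
      "(\<lambda>i. of_int (a i) * z ^ i) sums s" "(\<lambda>i. of_int (b i) * z ^ i) sums (s - 1 / z)"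
      "x = z * (1 - z) * s"
      using ifs_images_meet[OF nz(3,4) x] by (elim exE conjE)
    have c: "\<forall>i. b i - a i \<in> {-1, 0, 1}"
    proof
      show "b i - a i \<in> {-1, 0, 1}" for i using ab(1,2)[rule_format, of i] by auto
    qed
    have "(\<lambda>i. of_int (b i - a i) * z ^ i) sums (-1 / z)"
      using sums_diff[OF ab(4,3)] by (simp add: left_diff_distrib)
    from digits_nonzero[OF z c this] have d: "b i - a i \<in> {-1, 1}" for i .
    have one: "b i + a i = 1" for i
      using d[of i] ab(1)[rule_format, of i] ab(2)[rule_format, of i] by auto
    have "(\<lambda>i. of_int (b i + a i) * z ^ i) sums (s - 1 / z + s)"
      using sums_add[OF ab(4,3)] by (simp add: distrib_right)
    then have "s - 1 / z + s = 1 / (1 - z)" using geo unfolding one by (simp add: sums_unique2)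
    then have "z * (1 - z) * (s - 1 / z + s) = z" using z1 by simp
    moreover have "z * (1 - z) * (s - 1 / z + s) = 2 * (z * (1 - z) * s) - (1 - z)"
      using nz(3) by (simp add: field_simps)
    ultimately have "2 * (z * (1 - z) * s) - (1 - z) = z" by (simp only:)
    then have "2 * (z * (1 - z) * s) = 1" by (simp add: diff_eq_eq)
    then show ?thesis using ab(5) by (simp add: eq_divide_eq mult.commute)
  qed
  then have "ifs_f z ` Lambda z \<inter> ifs_g z ` Lambda z \<subseteq> {1/2}"
    by (intro subsetI) (simp only: singleton_iff)
  from subset_singletonD[OF this] show ?thesis using ne by argo
qed

text \<open>The derivative has imaginary part at least 1 in modulus at the centre, and changes by
  less than 1 because powers in the unit disc satisfy the Lipschitz bound \<open>n\<close>.\<close>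

lemma root_poly_deriv_nonzero:
  assumes z: "near z"
  shows "-2 + 4*z - 10*z^4 + 16*z^7 \<noteq> 0"
proof -
  define a where "a = Complex (371859 / 1000000) (519411 / 1000000)"
  have d: "cmod (z - a) \<le> 2 / 100000" using z by (simp add: near_def a_def)
  have a: "cmod a \<le> 1" unfolding a_def by (subst cmod_le_iff) (simp_all add: power2_eq_square)
  have n: "cmod (z ^ k - a ^ k) \<le> real k * (2 / 100000)" for k
    using norm_power_diff[of z a k] near_norm(4)[OF z] a mult_left_mono[OF d, of "real k"]
    by linarith
  have tri: "cmod (4 * A - 10 * B + 16 * C) \<le> 4 * cmod A + 10 * cmod B + 16 * cmod C" for A B C
    using norm_triangle_ineq[of "4 * A - 10 * B" "16 * C"] norm_triangle_ineq4[of "4 * A" "10 * B"]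
    by (simp add: norm_mult)
  have a2: "a ^ 2 = Complex (-131508671040 / 1000000000000) (386295310098 / 1000000000000)"
    by (simp add: a_def power2_eq_square complex_mult)
  have a4: "a ^ 4 = (a ^ 2) ^ 2" by simp
  have a7: "a ^ 7 = a ^ 4 * a ^ 2 * a" by algebra
  have "1 \<le> \<bar>Im (-2 + 4 * a - 10 * a ^ 4 + 16 * a ^ 7)\<bar>"
    unfolding a7 a4 a2 power2_eq_square complex_mult by (simp add: a_def)
  then have "1 \<le> cmod (-2 + 4 * a - 10 * a ^ 4 + 16 * a ^ 7)"
    using abs_Im_le_cmod order_trans by blast
  moreover have "cmod ((-2 + 4*z - 10*z^4 + 16*z^7) - (-2 + 4 * a - 10 * a ^ 4 + 16 * a ^ 7)) < 1"
  proof -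
    have "(-2 + 4*z - 10*z^4 + 16*z^7) - (-2 + 4 * a - 10 * a ^ 4 + 16 * a ^ 7)
        = 4 * (z ^ 1 - a ^ 1) - 10 * (z^4 - a^4) + 16 * (z^7 - a^7)" by (simp add: algebra_simps)
    also have "cmod \<dots> \<le> 4 * cmod (z ^ 1 - a ^ 1) + 10 * cmod (z^4 - a^4) + 16 * cmod (z^7 - a^7)"
      by (rule tri)
    also have "\<dots> < 1" using n[of 1] n[of 4] n[of 7] by linarith
    finally show ?thesis .
  qed
  ultimately show ?thesis by (metis (no_types, lifting) diff_0 norm_minus_cancel not_le)
qed

lemma offset_deriv:
  assumes z: "near z" "root_poly z = 0"
  shows "\<exists>D. D \<noteq> 0 \<and> (offset has_field_derivative D) (at z)"
proof -
  note nz = near_norm[OF z(1)]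
  have z1: "1 - z \<noteq> 0" using nz(4) by auto
  let ?q = "\<lambda>w. 1 / ((1 - w) * w ^ 8)"
  have "?q field_differentiable at z"
    using nz(3) z1 by (intro derivative_intros) auto
  then obtain q' where q: "(?q has_field_derivative q') (at z)"
    by (auto simp: field_differentiable_def)
  have P: "(root_poly has_field_derivative (-2 + 4*z - 10*z^4 + 16*z^7)) (at z)"
    unfolding root_poly_def by (auto intro!: derivative_eq_intros)
  have "((\<lambda>w. root_poly w * ?q w) has_field_derivative ((-2 + 4*z - 10*z^4 + 16*z^7) * ?q z + q' * root_poly z)) (at z)"
    by (rule DERIV_mult[OF P q])
  then have "(offset has_field_derivative ((-2 + 4*z - 10*z^4 + 16*z^7) * ?q z)) (at z)"
    using z(2) by (simp add: offset_def[abs_def])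
  moreover have "(-2 + 4*z - 10*z^4 + 16*z^7) * ?q z \<noteq> 0"
    using root_poly_deriv_nonzero[OF z(1)] nz(3) z1 by simp
  ultimately show ?thesis by blast
qed

lemma fixed_point_dist:
  assumes "near z" "near z'"
  shows "cmod (1 / (1 - z) - 1 / (1 - z')) \<le> 80 / 1048576"
  using norm_triangle_ineq4[of "1 / (1 - z) - grid 991427 819813" "1 / (1 - z') - grid 991427 819813"]
    near_fixed_point[OF assms(1)] near_fixed_point[OF assms(2)] by simp

subsection \<open>Loops and holes\<close>

lemma connected_meets_sphere:
  fixes C :: "complex set"
  assumes "connected C" "x \<in> C" "dist a x < r" "y \<in> C" "r < dist a y"
  shows "C \<inter> sphere a r \<noteq> {}"
proof -
  have "0 < r" using assms(3) zero_le_dist[of a x] by linarith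
  moreover have "C \<inter> ball a r \<noteq> {}" "C - ball a r \<noteq> {}" using assms by auto
  ultimately show ?thesis
    using connected_Int_frontier[OF assms(1), of "ball a r"] by (simp add: frontier_ball)
qed

theorem theorem9p1p1:
  fixes \<omega> :: complex
  assumes root: "1 - 2*\<omega> + 2*\<omega>^2 - 2*\<omega>^5 + 2*\<omega>^8 = 0"
    and approx: "cmod (\<omega> - Complex 0.371859 0.519411) < 0.00001"
  shows "\<omega> \<in> Mset \<and> \<omega> \<in> M0 \<and> \<omega> \<in> M1
    \<and> ifs_f \<omega> ` Lambda \<omega> \<inter> ifs_g \<omega> ` Lambda \<omega> = {1/2}
    \<and> (\<forall>e>0. \<exists>z \<in> punctured_disc - Mset. cmod (z - \<omega>) < e)
    \<and> (\<exists>\<gamma> :: nat \<Rightarrow> real \<Rightarrow> complex.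
         (\<forall>n. simple_path (\<gamma> n) \<and> pathfinish (\<gamma> n) = pathstart (\<gamma> n)
              \<and> path_image (\<gamma> n) \<subseteq> interior Mset
              \<and> \<omega> \<notin> path_image (\<gamma> n)
              \<and> winding_number (\<gamma> n) \<omega> \<noteq> 0
              \<and> (\<forall>w \<in> path_image (\<gamma> (Suc n)).
                    w \<notin> path_image (\<gamma> n) \<and> winding_number (\<gamma> n) w \<noteq> 0))
         \<and> (\<forall>e>0. \<exists>N. \<forall>n\<ge>N. path_image (\<gamma> n) \<subseteq> ball \<omega> e))
    \<and> infinite {H. hole H}
    \<and> (\<forall>e>0. \<exists>H. hole H \<and> H \<inter> ball \<omega> e \<noteq> {})"
proof -

  \<comment> \<open>Membership of \<omega> and the overlap of the halves\<close>
  let ?a = "Complex (371859 / 1000000) (519411 / 1000000)"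
  have ap: "cmod (\<omega> - ?a) < 1 / 100000" using approx by simp
  have near_ball: "near z" if "cmod (z - \<omega>) < 1 / 100000" for z
    using norm_triangle_ineq[of "z - \<omega>" "\<omega> - ?a"] that ap by (simp add: near_def)
  have nw: "near \<omega>" by (rule near_ball) simp
  note nz = near_norm[OF nw]
  have P0: "root_poly \<omega> = 0" using root by (simp add: root_poly_def)
  then have v0: "offset \<omega> = 0" by (simp add: offset_def)
  have meet: "ifs_f \<omega> ` Lambda \<omega> \<inter> ifs_g \<omega> ` Lambda \<omega> = {1/2}"
    by (rule ifs_images_meet_half[OF nw v0])
  have pd: "z \<in> punctured_disc" if "near z" for z
    using near_norm(3,4)[OF that] by (simp add: punctured_disc_def)
  have conn: "connected (Lambda \<omega>)" using connected_Lambda_iff[OF nz(3,4)] meet by simp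
  have ful: "full (Lambda \<omega>)" using full_Lambda[OF nz(3,4)] meet by simp
  have M: "\<omega> \<in> Mset" "\<omega> \<in> M1" using pd[OF nw] conn ful by (simp_all add: Mset_def M1_def)
  have "1/2 \<in> ifs_f \<omega> ` Lambda \<omega> \<union> ifs_g \<omega> ` Lambda \<omega>" using meet by blast
  then have "1/2 \<in> Lambda \<omega>" using Lambda_invariant[OF nz(3,4)] by metis
  then have M0: "\<omega> \<in> M0" using pd[OF nw] by (simp add: M0_def)

  \<comment> \<open>Rescaled parameters near \<omega>\<close>
  obtain D where D: "D \<noteq> 0" "(offset has_field_derivative D) (at \<omega>)"
    using offset_deriv[OF nw P0] by blast
  \<comment> \<open>The tolerance of 100 units plus the 80 of \<open>fixed_point_dist\<close> fits
    into the radius 524 of the hole and the half-width of the annulus.\<close>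
  obtain N where N: "\<And>k u. N \<le> k \<Longrightarrow> cmod u \<le> 1 \<Longrightarrow> cmod (\<omega> ^ k * u / D) < 1 / 100000 \<and>
      cmod (offset (\<omega> + \<omega> ^ k * u / D) / (\<omega> + \<omega> ^ k * u / D) ^ k - u) < 100 / 1048576"
    using rescaled_limit[OF D(2) v0 D(1) nz(3,4), of "100 / 1048576" "1 / 100000"] by auto
  define c where "c k = \<omega> ^ k / D" for k
  have c0: "c k \<noteq> 0" for k using nz(3) D(1) by (simp add: c_def)
  have N': "near (\<omega> + c k * u)"
    "cmod (offset (\<omega> + c k * u) / (\<omega> + c k * u) ^ k - u) < 100 / 1048576"
    if "N \<le> k" "cmod u \<le> 1" for k u
    using N[OF that] near_ball[of "\<omega> + c k * u"] by (simp_all add: c_def)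
  have clim: "(\<lambda>k. cmod (c k)) \<longlonglongrightarrow> 0"
  proof -
    have "(\<lambda>k. \<omega> ^ k / D) \<longlonglongrightarrow> 0 / D"
      using D(1) nz(4) by (intro tendsto_divide tendsto_const LIMSEQ_power_zero) auto
    then show ?thesis by (simp add: c_def[abs_def] tendsto_norm_zero)
  qed
  let ?p = "1 / (1 - \<omega>)"

  \<comment> \<open>Parameters outside the connectedness locus\<close>
  have outer: "\<exists>z \<in> punctured_disc - Mset. cmod (z - \<omega>) < e" if e: "0 < e" for e
  proof -
    \<comment> \<open>Makes the limiting tail \<open>?p - u\<close> the centre of the hole.\<close>
    define u where "u = ?p - grid 990420 727926"
    have "cmod (grid 991427 819813 - grid 990420 727926) \<le> 99000 / 1048576"
    proof -
      have "grid 991427 819813 - grid 990420 727926 = Complex (1007 / 1048576) (91887 / 1048576)"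
        by (simp add: grid_def complex_eq_iff)
      moreover have "cmod (Complex (1007 / 1048576) (91887 / 1048576)) \<le> 99000 / 1048576"
        by (subst cmod_le_iff) (simp_all add: power2_eq_square)
      ultimately show ?thesis by (simp only:)
    qed
    then have u: "cmod u \<le> 99100 / 1048576"
      using near_fixed_point[OF nw]
        norm_triangle_ineq[of "?p - grid 991427 819813" "grid 991427 819813 - grid 990420 727926"]
      by (simp add: u_def)
    have "\<forall>\<^sub>F k in sequentially. cmod (c k) < e" using clim e by (rule order_tendstoD(2))
    then obtain K where "\<And>k. K \<le> k \<Longrightarrow> cmod (c k) < e" by (auto simp: eventually_sequentially)
    then obtain k where k: "N \<le> k" "cmod (c k) < e" by (metis max.cobounded1 max.cobounded2)
    define z where "z = \<omega> + c k * u"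
    have u1: "cmod u \<le> 1" using u by simp
    have z: "near z" "cmod (offset z / z ^ k - u) < 100 / 1048576"
      unfolding z_def using N'[OF k(1) u1] by blast+
    have "z \<notin> Mset"
    proof
      assume zM: "z \<in> Mset"
      have "cmod (offset z / z ^ k) \<le> cmod (offset z / z ^ k - u) + cmod u"
        using norm_triangle_ineq[of "offset z / z ^ k - u" u] by simp
      then have "cmod (offset z / z ^ k) \<le> 99574 / 1048576" using z(2) u by linarith
      from Mset_imp_mem_diffset[OF z(1) zM this]
      have mem: "1 / (1 - z) - offset z / z ^ k \<in> diffset z" .
      have "cmod ((1 / (1 - z) - ?p) - (offset z / z ^ k - u)) \<le> 524 / 1048576"
        using norm_triangle_ineq4[of "1 / (1 - z) - ?p" "offset z / z ^ k - u"]
          fixed_point_dist[OF z(1) nw] z(2) by linarith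
      moreover have "(1 / (1 - z) - ?p) - (offset z / z ^ k - u)
          = 1 / (1 - z) - offset z / z ^ k - grid 990420 727926"
        by (simp add: u_def)
      ultimately have "1 / (1 - z) - offset z / z ^ k \<in> disc (990420, 727926, 524)"
        by (simp only: disc_def prod.case mem_cball dist_norm norm_minus_commute[of "grid _ _"])
      then show False using escapes_sound[OF z(1) _ escapes_hole] mem by blast
    qed
    moreover have "cmod (z - \<omega>) < e"
    proof -
      have "cmod (z - \<omega>) = cmod (c k) * cmod u" by (simp add: z_def norm_mult)
      also have "\<dots> \<le> cmod (c k)" using u1 by (intro mult_left_le) auto
      finally show ?thesis using k(2) by linarith
    qed
    ultimately show ?thesis using pd[OF z(1)] by blast
  qed

  \<comment> \<open>Nested circles inside the connectedness locus\<close>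
  define m where "m = ?p - grid 797944 714253"
  \<comment> \<open>The middle of the annulus, rounded down: at least 524 units remain on either
    side, enough for the 300 allowed in \<open>inM\<close> and the error of 180.\<close>
  define r :: real where "r = 356515 / 1048576"
  have m: "cmod m \<le> 220500 / 1048576"
  proof -
    have "grid 991427 819813 - grid 797944 714253 = Complex (193483 / 1048576) (105560 / 1048576)"
      by (simp add: grid_def complex_eq_iff)
    moreover have "cmod (Complex (193483 / 1048576) (105560 / 1048576)) \<le> 220410 / 1048576"
      by (subst cmod_le_iff) (simp_all add: power2_eq_square)
    ultimately have "cmod (grid 991427 819813 - grid 797944 714253) \<le> 220410 / 1048576"
      by (simp only:)
    then show ?thesis
      using near_fixed_point[OF nw]
        norm_triangle_ineq[of "?p - grid 991427 819813" "grid 991427 819813 - grid 797944 714253"]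
      by (simp add: m_def)
  qed
  have inM: "\<omega> + c k * u \<in> Mset" if k: "N \<le> k" and u: "\<bar>cmod (u - m) - r\<bar> < 300 / 1048576" for k u
  proof -
    have "cmod u \<le> cmod (u - m) + cmod m" using norm_triangle_ineq[of "u - m" m] by simp
    then have u1: "cmod u \<le> 1" using m u unfolding r_def by linarith
    define z where "z = \<omega> + c k * u"
    have z: "near z" "cmod (offset z / z ^ k - u) < 100 / 1048576"
      unfolding z_def using N'[OF k u1] by blast+
    let ?t = "1 / (1 - z) - offset z / z ^ k" and ?d = "(1 / (1 - z) - ?p) - (offset z / z ^ k - u)"
    have d: "cmod ?d \<le> 180 / 1048576"
      using norm_triangle_ineq4[of "1 / (1 - z) - ?p" "offset z / z ^ k - u"]
        fixed_point_dist[OF z(1) nw] z(2) by linarith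
    have t: "?t - grid 797944 714253 = ?d - (u - m)" by (simp add: m_def)
    have "cmod (?t - grid 797944 714253) \<le> cmod ?d + cmod (u - m)"
      "cmod (u - m) \<le> cmod ?d + cmod (?t - grid 797944 714253)"
      unfolding t using norm_triangle_ineq4[of ?d "u - m"] norm_triangle_ineq4[of ?d "?d - (u - m)"]
      by simp_all
    then have "355991 / 1048576 \<le> cmod (?t - grid 797944 714253)"
      "cmod (?t - grid 797944 714253) \<le> 357040 / 1048576"
      using d u unfolding r_def by linarith+
    then have "?t \<in> diffset z" by (rule annulus_subset[OF z(1)])
    then show ?thesis unfolding z_def[symmetric] by (rule mem_diffset_imp_Mset[OF z(1)])
  qed
  \<comment> \<open>Steps of 4 make each circle fit inside the previous one: \<omega> is within
    220500 scaled units of the centre, so the new circle stays within 577015 of \<omega>, and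
    \<open>cmod \<omega> ^ 4\<close> shrinks this below 136000, less than the radius 356515 minus
    220500.\<close>
  define cen where "cen n = \<omega> + c (N + 4 * n) * m" for n
  define rad where "rad n = cmod (c (N + 4 * n)) * r" for n
  have rad0: "0 < rad n" for n using c0 by (simp add: rad_def r_def)
  have sphere_int: "sphere (cen n) (rad n) \<subseteq> interior Mset" for n
  proof -
    let ?k = "N + 4 * n"
    let ?A = "{w. \<bar>cmod ((w - \<omega>) / c ?k - m) - r\<bar> < 300 / 1048576}"
    have "open ?A" using c0[of ?k] by (intro open_Collect_less continuous_intros) auto
    moreover have "?A \<subseteq> Mset"
    proof
      fix w assume "w \<in> ?A"
      then have "\<omega> + c ?k * ((w - \<omega>) / c ?k) \<in> Mset" by (intro inM) auto
      then show "w \<in> Mset" using c0[of ?k] by simp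
    qed
    moreover have "sphere (cen n) (rad n) \<subseteq> ?A"
    proof
      fix w assume "w \<in> sphere (cen n) (rad n)"
      then have "cmod (w - cen n) = cmod (c ?k) * r"
        by (simp add: dist_norm norm_minus_commute rad_def)
      moreover have "(w - \<omega>) / c ?k - m = (w - cen n) / c ?k"
        using c0[of ?k] by (simp add: cen_def field_simps)
      ultimately have "cmod ((w - \<omega>) / c ?k - m) = r" using c0[of ?k] by (simp add: norm_divide)
      then show "w \<in> ?A" by simp
    qed
    ultimately show ?thesis using interior_maximal by blast
  qed
  have sphere_M: "sphere (cen n) (rad n) \<subseteq> Mset" for n
    using sphere_int interior_subset by blast
  have cen_le: "dist (cen n) \<omega> \<le> cmod (c (N + 4 * n)) * (220500 / 1048576)" for n
  proof -
    have "dist (cen n) \<omega> = cmod (c (N + 4 * n)) * cmod m" by (simp add: cen_def dist_norm norm_mult)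
    then show ?thesis using mult_left_mono[OF m norm_ge_zero, of "c (N + 4 * n)"] by (simp only:)
  qed
  have cen_in: "dist (cen n) w < rad n"
    if "dist \<omega> w < cmod (c (N + 4 * n)) * (136000 / 1048576)" for n w
  proof -
    have "dist (cen n) w < cmod (c (N + 4 * n)) * (220500 / 1048576) + cmod (c (N + 4 * n)) * (136000 / 1048576)"
      using dist_triangle[of "cen n" w \<omega>] cen_le[of n] that by linarith
    then show ?thesis
      using norm_ge_zero[of "c (N + 4 * n)"] unfolding rad_def r_def by linarith
  qed
  have disc_le: "dist \<omega> w \<le> cmod (c (N + 4 * n))" if "dist (cen n) w \<le> rad n" for n w
  proof -
    have "dist \<omega> w \<le> cmod (c (N + 4 * n)) * (220500 / 1048576) + rad n"
      using dist_triangle[of \<omega> w "cen n"] cen_le[of n] that by (simp add: dist_commute)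
    also have "\<dots> \<le> cmod (c (N + 4 * n))"
      using norm_ge_zero[of "c (N + 4 * n)"] unfolding rad_def r_def by linarith
    finally show ?thesis .
  qed
  have nest: "dist (cen n) w < rad n" if "w \<in> sphere (cen (Suc n)) (rad (Suc n))" for n w
  proof (rule cen_in)
    have "dist \<omega> w \<le> cmod (c (N + 4 * Suc n)) * (220500 / 1048576) + rad (Suc n)"
      using dist_triangle[of \<omega> w "cen (Suc n)"] cen_le[of "Suc n"] that by (simp add: dist_commute)
    also have "\<dots> = cmod (c (N + 4 * Suc n)) * (577015 / 1048576)"
      by (simp add: rad_def r_def)
    also have "cmod (c (N + 4 * Suc n)) = cmod (c (N + 4 * n)) * cmod \<omega> ^ 4"
      by (simp add: c_def norm_mult norm_divide norm_power power_add)
    also have "\<dots> * (577015 / 1048576) = cmod (c (N + 4 * n)) * (cmod \<omega> ^ 4 * (577015 / 1048576))"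
      by simp
    also have "\<dots> < cmod (c (N + 4 * n)) * (136000 / 1048576)"
    proof (rule mult_strict_left_mono)
      have "cmod \<omega> ^ 4 \<le> (6389 / 10000) ^ 4" using nz(2) by (intro power_mono) auto
      then have "cmod \<omega> ^ 4 \<le> 17 / 100" by (rule order_trans) (simp add: power_numeral_even)
      then show "cmod \<omega> ^ 4 * (577015 / 1048576) < 136000 / 1048576" by simp
      show "0 < cmod (c (N + 4 * n))" using c0 by simp
    qed
    finally show "dist \<omega> w < cmod (c (N + 4 * n)) * (136000 / 1048576)" .
  qed
  have klim: "(\<lambda>n. cmod (c (N + 4 * n))) \<longlonglongrightarrow> 0"
    using LIMSEQ_subseq_LIMSEQ[OF clim, of "\<lambda>n. N + 4 * n"] by (simp add: strict_mono_def o_def)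
  have small: "\<forall>\<^sub>F n in sequentially. cmod (c (N + 4 * n)) < e" if "0 < e" for e
    using klim that by (rule order_tendstoD(2))
  define \<gamma> where "\<gamma> n = circlepath (cen n) (rad n)" for n
  have im: "path_image (\<gamma> n) = sphere (cen n) (rad n)" for n
    using rad0[of n] by (simp add: \<gamma>_def path_image_circlepath_nonneg less_imp_le)
  have win: "w \<notin> path_image (\<gamma> n) \<and> winding_number (\<gamma> n) w \<noteq> 0" if "dist (cen n) w < rad n" for n w
    using that winding_number_circlepath[of w "cen n" "rad n"] unfolding im
    by (simp add: \<gamma>_def dist_norm norm_minus_commute)
  have w_in: "dist (cen n) \<omega> < rad n" for n using c0 by (intro cen_in) simp
  have loops: "(\<forall>n. simple_path (\<gamma> n) \<and> pathfinish (\<gamma> n) = pathstart (\<gamma> n)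
              \<and> path_image (\<gamma> n) \<subseteq> interior Mset
              \<and> \<omega> \<notin> path_image (\<gamma> n)
              \<and> winding_number (\<gamma> n) \<omega> \<noteq> 0
              \<and> (\<forall>w \<in> path_image (\<gamma> (Suc n)).
                    w \<notin> path_image (\<gamma> n) \<and> winding_number (\<gamma> n) w \<noteq> 0))
         \<and> (\<forall>e>0. \<exists>N. \<forall>n\<ge>N. path_image (\<gamma> n) \<subseteq> ball \<omega> e)"
  proof (intro conjI allI impI ballI)
    fix n
    show "simple_path (\<gamma> n)" using rad0[of n] by (simp add: \<gamma>_def simple_path_circlepath)
    show "pathfinish (\<gamma> n) = pathstart (\<gamma> n)" by (simp add: \<gamma>_def)
    show "path_image (\<gamma> n) \<subseteq> interior Mset" unfolding im by (rule sphere_int)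
    show "\<omega> \<notin> path_image (\<gamma> n)" "winding_number (\<gamma> n) \<omega> \<noteq> 0" using win[OF w_in] by blast+
    fix w assume "w \<in> path_image (\<gamma> (Suc n))"
    then have "dist (cen n) w < rad n" unfolding im by (rule nest)
    then show "w \<notin> path_image (\<gamma> n)" "winding_number (\<gamma> n) w \<noteq> 0" using win by blast+
  next
    fix e :: real assume "0 < e"
    from small[OF this] obtain K where K: "\<And>n. K \<le> n \<Longrightarrow> cmod (c (N + 4 * n)) < e"
      by (auto simp: eventually_sequentially)
    have "path_image (\<gamma> n) \<subseteq> ball \<omega> e" if "K \<le> n" for n
    proof
      fix w assume "w \<in> path_image (\<gamma> n)"
      then have "dist \<omega> w \<le> cmod (c (N + 4 * n))" unfolding im by (intro disc_le) simp
      then show "w \<in> ball \<omega> e" using K[OF that] by simp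
    qed
    then show "\<exists>N. \<forall>n\<ge>N. path_image (\<gamma> n) \<subseteq> ball \<omega> e" by blast
  qed

  \<comment> \<open>Infinitely many holes accumulating at \<omega>\<close>
  have same_side: "dist (cen n) y \<le> rad n"
    if "H \<in> components (punctured_disc - Mset)" "x \<in> H" "y \<in> H" "dist (cen n) x < rad n" for H x y n
  proof (rule ccontr)
    assume "\<not> dist (cen n) y \<le> rad n"
    then have "H \<inter> sphere (cen n) (rad n) \<noteq> {}"
      using that
        by (intro connected_meets_sphere[of H x _ _ y]) (auto intro: in_components_connected)
    then show False using sphere_M in_components_subset[OF that(1)] by blast
  qed
  have hole_in: "\<exists>H x. hole H \<and> x \<in> H \<and> dist (cen n) x < rad n \<and> dist \<omega> x < e" if "0 < e" for n e
  proof -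
    \<comment> \<open>A circle this small leaves the point 1/4 outside, so a component with a point
      inside it is not the outer one.\<close>
    from small[of "1 / 10"] obtain j where j: "cmod (c (N + 4 * j)) < 1 / 10"
      by (auto simp: eventually_sequentially)
    let ?e = "min e (min (cmod (c (N + 4 * n)) * (136000 / 1048576)) (cmod (c (N + 4 * j)) * (136000 / 1048576)))"
    have "0 < ?e" using that c0 by simp
    from outer[OF this] obtain x where x: "x \<in> punctured_disc - Mset" "dist \<omega> x < ?e"
      by (auto simp: dist_norm norm_minus_commute)
    define H where "H = connected_component_set (punctured_disc - Mset) x"
    have H: "H \<in> components (punctured_disc - Mset)" "x \<in> H"
      using x(1) by (auto simp: H_def components_def connected_component_refl)
    have "\<not> {z. 0 < cmod z \<and> cmod z < 1/2} \<subseteq> H"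
    proof
      assume "{z. 0 < cmod z \<and> cmod z < 1/2} \<subseteq> H"
      moreover have "1/4 \<in> {z :: complex. 0 < cmod z \<and> cmod z < 1/2}" by simp
      ultimately have "1/4 \<in> H" by blast
      then have "dist (cen j) (1/4) \<le> rad j"
        using x(2) by (intro same_side[OF H]) (auto intro: cen_in)
      then have "dist \<omega> (1/4) \<le> cmod (c (N + 4 * j))" by (rule disc_le)
      then show False
        using j nz(1) norm_triangle_ineq2[of \<omega> "1/4"] by (simp add: dist_norm)
    qed
    then have "hole H" using H(1) by (simp add: hole_def)
    moreover have "dist (cen n) x < rad n" using x(2) by (intro cen_in) simp
    ultimately show ?thesis using H(2) x(2) by auto
  qed
  have inf: "infinite {H. hole H}"
  proof
    assume fin: "finite {H. hole H}"
    \<comment> \<open>Each hole has a point other than \<omega>, which the shrinking circles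
      eventually exclude. With finitely many holes one circle would do this for all of them,
      contradicting the hole found inside it.\<close>
    have "\<forall>H\<in>{H. hole H}. \<forall>\<^sub>F n in sequentially. \<exists>y\<in>H. rad n < dist (cen n) y"
    proof
      fix H assume "H \<in> {H. hole H}"
      then have H: "H \<in> components (punctured_disc - Mset)" by (simp add: hole_def)
      obtain y where y: "y \<in> H" using in_components_nonempty[OF H] by blast
      then have "y \<noteq> \<omega>" using in_components_subset[OF H] M(1) by blast
      then have "0 < dist \<omega> y" by simp
      from small[OF this] show "\<forall>\<^sub>F n in sequentially. \<exists>y\<in>H. rad n < dist (cen n) y"
      proof eventually_elim
        case (elim n)
        then have "\<not> dist (cen n) y \<le> rad n" using disc_le[of n y] by linarith
        then show ?case using y by force
      qed
    qed
    from eventually_ball_finite[OF fin this] obtain n where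
      n: "\<And>H. hole H \<Longrightarrow> \<exists>y\<in>H. rad n < dist (cen n) y"
      by (auto simp: eventually_sequentially)
    obtain H x where H: "hole H" "x \<in> H" "dist (cen n) x < rad n" using hole_in[of 1 n] by auto
    obtain y where "y \<in> H" "rad n < dist (cen n) y" using n[OF H(1)] by blast
    then show False using same_side[of H x y n] H by (auto simp: hole_def)
  qed
  have acc: "\<exists>H. hole H \<and> H \<inter> ball \<omega> e \<noteq> {}" if e: "0 < e" for e
  proof -
    obtain H x where "hole H" "x \<in> H" "dist \<omega> x < e" using hole_in[OF e, of 0] by blast
    then have "x \<in> H \<inter> ball \<omega> e" by simp
    then show ?thesis using \<open>hole H\<close> by blast
  qed
  show ?thesis
    using M M0 meet outer loops inf acc by blast
qed

end
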